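(* Let $\Omega\subset\mathbb{C}$ be a bounded John domain, let $z_0\in\Omega$, let $1<p<\infty$, and let $m\ge1$ be an integer. Assume that $mp>\dim_{\mathrm A}(\partial\Omega)$. Then there is a constant $C\ge1$, independent of $f$, such that every analytic function $f$ in $\Omega$ satisfies $$ C^{-1}\int_\Omega |f^{(m)}(z)|^p\delta(z)^{mp-2}\,dA(z) \le |f^{(m)}(z_0)|^p\delta(z_0)^{mp}+\int_\Omega |f^{(m+1)}(z)|^p\delta(z)^{(m+1)p-2}\,dA(z) \le C\int_\Omega |f^{(m)}(z)|^p\delta(z)^{mp-2}\,dA(z). $$
   Context: $\delta(z)=\operatorname{dist}(z,\partial\Omega)$ is the Euclidean distance to the boundary and $dA=dx\,dy$ is Euclidean area measure. A domain is a nonempty connected open set. Inequalities involving possibly infinite integrals are understood in the extended sense (values in $[0,\infty]$). $f^{(k)}$ denotes the $k$-th complex derivative. John domain: a bounded domain $\Omega\subset\mathbb{C}$ is a John domain if there exist a point $x_0\in\Omega$ and a constant $C_J>0$ such that every $x\in\Omega$ can be joined to $x_0$ by a rectifiable curve $\gamma:[0,\ell]\to\Omega$, parametrized by arclength starting from $x$ (so $\gamma(0)=x$, $\gamma(\ell)=x_0$), with $\delta(\gamma(t))\ge C_J t$ for $0\le t\le \ell$. Assouad dimension: for $E\subset\mathbb{C}$, $\dim_{\mathrm A}(E)$ is the infimum of all exponents $s\ge0$ for which there is a constant $C>0$ such that $N_r(E\cap B(x,R))\le C(R/r)^s$ for all $x\in E$ and all $0<r<R$, where $B(x,R)$ is the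 open ball and $N_r(A)$ is the smallest number of open balls of radius $r$ needed to cover $A$. *)

theory Defs
  imports "HOL-Analysis.Analysis"
begin

definition bdist :: "complex set \<Rightarrow> complex \<Rightarrow> real" where
  "bdist \<Omega> z = infdist z (frontier \<Omega>)"

definition curve_length :: "(real \<Rightarrow> complex) \<Rightarrow> real \<Rightarrow> real \<Rightarrow> ennreal" where
  "curve_length \<gamma> a b =
     (SUP (n, t) \<in> {(n :: nat, t). mono_on {..n} t \<and> t ` {..n} \<subseteq> {a..b}}.
        \<Sum>i<n. ennreal (dist (\<gamma> (t i)) (\<gamma> (t (Suc i)))))"

text \<open>The condition on initial segments says that the parameter is the length travelled so far;
  taking \<open>t = l\<close> makes the curve rectifiable with total length \<open>l\<close>.\<close>

definition arclength_param :: "(real \<Rightarrow> complex) \<Rightarrow> real \<Rightarrow> bool" where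
  "arclength_param \<gamma> l \<longleftrightarrow>
     0 \<le> l \<and> continuous_on {0..l} \<gamma> \<and> (\<forall>t\<in>{0..l}. curve_length \<gamma> 0 t = ennreal t)"

definition john_domain :: "complex set \<Rightarrow> bool" where
  "john_domain \<Omega> \<longleftrightarrow>
     \<Omega> \<noteq> {} \<and> open \<Omega> \<and> connected \<Omega> \<and> bounded \<Omega> \<and>
     (\<exists>x0\<in>\<Omega>. \<exists>C>0. \<forall>x\<in>\<Omega>. \<exists>\<gamma> l.
        arclength_param \<gamma> l \<and> \<gamma> ` {0..l} \<subseteq> \<Omega> \<and> \<gamma> 0 = x \<and> \<gamma> l = x0 \<and>
        (\<forall>t\<in>{0..l}. C * t \<le> bdist \<Omega> (\<gamma> t)))"

text \<open>Ball centres may lie anywhere in the plane. The value is \<open>\<infinity>\<close> if no finite cover exists.\<close>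

definition covering_number :: "real \<Rightarrow> complex set \<Rightarrow> enat" where
  "covering_number r A = (INF F \<in> {F. finite F \<and> A \<subseteq> (\<Union>c\<in>F. ball c r)}. enat (card F))"

definition assouad_dim :: "complex set \<Rightarrow> ereal" where
  "assouad_dim E =
     Inf (ereal ` {s. 0 \<le> s \<and> (\<exists>C>0. \<forall>x\<in>E. \<forall>r R. 0 < r \<longrightarrow> r < R \<longrightarrow>
       ereal_of_enat (covering_number r (E \<inter> ball x R)) \<le> ereal (C * (R / r) powr s))})"

end

theory Submission
  imports Defs "HOL-Complex_Analysis.Complex_Analysis"
begin

text \<open>Write \<open>g = f\<^sup>(\<^sup>m\<^sup>)\<close>, \<open>a = m p\<close> and \<open>\<delta>\<close> for the distance to the boundary. The second inequality is local: the
  Cauchy estimate and the sub-mean value property bound \<open>|g'(z)|\<^sup>p \<delta>(z)\<^sup>p\<close> by a mean of \<open>|g|\<^sup>p\<close> over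
  the disc of radius \<open>\<delta>(z)/2\<close>, and Tonelli's theorem does the rest. For the first one, integrate \<open>|g'|\<close> along the
  John curve from \<open>x\<close> and replace it by its means over discs; the John condition turns this into
  \<open>|g(x) - g(z\<^sub>0)| \<le> c \<integral> |g'(w)| / \<delta>(w) dA(w)\<close>, the integral being over \<open>|x - w| \<le> K \<delta>(w)\<close>. The Schur test with a
  small negative power of \<open>\<delta>\<close> as test function shows that this operator is bounded on the weighted \<open>L\<^sup>p\<close>
  space. One half of the test holds in every domain; the other half is
  \<open>\<integral> \<delta>\<^sup>b\<^sup>-\<^sup>2 \<le> C R\<^sup>b\<close> over discs of radius \<open>R\<close> centred on the boundary, which follows from the covering
  condition on dyadic layers as soon as \<open>b\<close> exceeds the Assouad dimension.\<close>

subsection \<open>Sub-mean value inequalities\<close>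

text \<open>The condition |x - w| \<le> K \<delta>(w) is not symmetric, and this decides where the
  boundary enters. For fixed x it describes a cone-like set on which \<delta>(w) is bounded below by
  multiples of |x - w| and of \<delta>(x), so the shape of the boundary is invisible. For fixed w it
  describes the part in \<Omega> of a disc about w that may reach the boundary, and only there does
  the dimension matter. The test power must not be trivial: for \<delta>^(-2) the bounds on the
  dyadic layers of the cone do not decay, whereas for \<delta>^(-2-s) they sum geometrically. The
  price is a factor \<delta>(x)^(-t) with t = s (p - 1), which lowers the exponent a of the weight
  to a - t; the strict inequality between a and the dimension pays for it. Values of g' on a curve
  are replaced by area means because the weighted norms do not see null sets. No integrability of f
  is assumed, so estimates are carried out in [0, \<infinity>]. The constant g(z0) is treated apart:
  its weighted norm is finite because \<delta>^(a-2) is integrable over \<Omega>.\<close>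

lemma holder_nn_integral_powr:
  fixes u v :: "'a \<Rightarrow> real" and p q A X :: real
  assumes "1 < p" "1/p + 1/q = 1" "0 < A" "0 \<le> X"
    and [measurable]: "u \<in> borel_measurable M" "v \<in> borel_measurable M"
    and nonneg: "\<And>x. 0 \<le> u x" "\<And>x. 0 \<le> v x"
    and X: "ennreal X \<le> (\<integral>\<^sup>+x. ennreal (u x * v x) \<partial>M)"
    and A: "(\<integral>\<^sup>+x. ennreal (v x powr q) \<partial>M) \<le> ennreal A"
  shows "ennreal (X powr p) \<le> ennreal (A powr (p - 1)) * (\<integral>\<^sup>+x. ennreal (u x powr p) \<partial>M)"
proof (cases "(\<integral>\<^sup>+x. ennreal (u x powr p) \<partial>M) = \<infinity>")
  case True
  then show ?thesis using \<open>0 < A\<close> by (simp add: ennreal_mult_eq_top_iff ennreal_top_mult)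
next
  case False
  then obtain B where B: "(\<integral>\<^sup>+x. ennreal (u x powr p) \<partial>M) = ennreal B" "0 \<le> B"
    by (cases "(\<integral>\<^sup>+x. ennreal (u x powr p) \<partial>M)") auto
  have "q > 1"
  proof -
    have "1 / q = 1 - 1 / p" using assms(2) by simp
    then have "0 < 1 / q" "1 / q < 1" using \<open>1 < p\<close> by auto
    then show ?thesis by (simp add: divide_less_eq split: if_splits)
  qed
  have young: "X \<le> l powr p * B / p + l powr (-q) * A / q" if l: "l > 0" for l
  proof -
    have "u x * v x \<le> l powr p / p * (u x powr p) + l powr (-q) / q * (v x powr q)" for x
      using Youngs_inequality[OF \<open>1 < p\<close> \<open>1 < q\<close> assms(2), of "l * u x" "v x / l"] nonneg[of x] l
      by (simp add: powr_mult powr_divide powr_minus_divide)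
    then have "ennreal X \<le> (\<integral>\<^sup>+x. ennreal (l powr p / p) * ennreal (u x powr p) + ennreal (l powr (-q) / q) * ennreal (v x powr q) \<partial>M)"
      using \<open>1 < p\<close> \<open>1 < q\<close>
      by (intro order_trans[OF X] nn_integral_mono) (simp flip: ennreal_mult ennreal_plus add: ennreal_leI)
    also have "\<dots> = ennreal (l powr p / p) * ennreal B + ennreal (l powr (-q) / q) * (\<integral>\<^sup>+x. ennreal (v x powr q) \<partial>M)"
      by (subst nn_integral_add) (auto simp: nn_integral_cmult B)
    also have "\<dots> \<le> ennreal (l powr p / p) * ennreal B + ennreal (l powr (-q) / q) * ennreal A"
      by (intro add_mono mult_left_mono A order_refl) simp
    also have "\<dots> = ennreal (l powr p * B / p + l powr (-q) * A / q)"
      using \<open>1 < p\<close> \<open>1 < q\<close> \<open>0 \<le> B\<close> \<open>0 < A\<close> by (simp flip: ennreal_mult ennreal_plus)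
    finally show ?thesis
      using \<open>1 < p\<close> \<open>1 < q\<close> \<open>0 \<le> B\<close> \<open>0 < A\<close> by (subst (asm) ennreal_le_iff) (auto intro!: add_nonneg_nonneg)
  qed
  have pq: "p + q = p * q" "p / q = p - 1"
    using assms(2) \<open>1 < p\<close> \<open>1 < q\<close> by (auto simp: field_simps)
  \<comment> \<open>The \<open>p\<close>-th power makes the bound linear in the integral of
    \<open>u powr p\<close>, the form to which Tonelli's theorem applies later.\<close>
  have "X powr p \<le> A powr (p - 1) * B"
  proof (cases "B = 0")
    case True
    have "X \<le> e" if "e > 0" for e
    proof -
      \<comment> \<open>This scale makes the only surviving term \<open>l powr (-q) * A / q\<close>
        equal to \<open>e\<close>.\<close>
      define l where "l = (e * q / A) powr (-1/q)"
      have "l > 0" "l powr (-q) = e * q / A"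
        using that \<open>0 < A\<close> \<open>1 < q\<close> by (auto simp: l_def powr_powr)
      with young[of l] True \<open>0 < A\<close> \<open>1 < q\<close> show ?thesis by simp
    qed
    then have "X \<le> 0" using field_le_epsilon[of X 0] by auto
    with \<open>0 \<le> X\<close> True show ?thesis by simp
  next
    case False
    with B have "B > 0" by simp
    \<comment> \<open>The minimising scale: because \<open>p + q = p * q\<close>, it makes
      \<open>l powr p * B\<close> and \<open>l powr (-q) * A\<close> equal.\<close>
    define l where "l = (A / B) powr (1 / (p * q))"
    have "l > 0" using \<open>B > 0\<close> \<open>A > 0\<close> by (auto simp: l_def)
    have l1: "l powr p = A powr (1/q) * B powr (-1/q)"
      using \<open>B > 0\<close> \<open>A > 0\<close> \<open>1 < p\<close> \<open>1 < q\<close>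
      by (simp add: l_def powr_powr powr_divide powr_minus_divide)
    have l2: "l powr (-q) = A powr (-1/p) * B powr (1/p)"
      using \<open>B > 0\<close> \<open>A > 0\<close> \<open>1 < p\<close> \<open>1 < q\<close>
      by (simp add: l_def powr_powr powr_divide powr_minus_divide)
    have e1: "1 / q = 1 - 1 / p" "1 / p = 1 - 1 / q" using assms(2) by auto
    have "l powr p * B = A powr (1/q) * (B powr (-1/q) * B powr 1)" unfolding l1 using \<open>B > 0\<close> by simp
    also have "\<dots> = A powr (1/q) * B powr (1/p)" 
      unfolding powr_add[symmetric] using e1 by simp
    finally have l3: "l powr p * B = A powr (1/q) * B powr (1/p)" .
    have "l powr (-q) * A = B powr (1/p) * (A powr (-1/p) * A powr 1)" unfolding l2 using \<open>A > 0\<close> by simp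
    also have "\<dots> = A powr (1/q) * B powr (1/p)" 
      unfolding powr_add[symmetric] using e1 by simp
    finally have l4: "l powr (-q) * A = A powr (1/q) * B powr (1/p)" .
    have "X \<le> A powr (1/q) * B powr (1/p) * (1/p + 1/q)"
      using young[OF \<open>l > 0\<close>] unfolding l3 l4 by (simp add: algebra_simps)
    then have "X \<le> A powr (1/q) * B powr (1/p)" using assms(2) by simp
    then have "X powr p \<le> (A powr (1/q) * B powr (1/p)) powr p"
      using \<open>0 \<le> X\<close> \<open>1 < p\<close> by (intro powr_mono2) auto
    also have "\<dots> = A powr (p - 1) * B"
      using \<open>B > 0\<close> \<open>A > 0\<close> \<open>1 < p\<close> pq by (simp add: powr_mult powr_powr)
    finally show ?thesis .
  qed
  with B show ?thesis by (simp flip: ennreal_mult add: ennreal_leI)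
qed

section \<open>Invariance of planar Lebesgue measure and means over discs\<close>

lemma nn_integral_lborel_shift:
  fixes F :: "'a::euclidean_space \<Rightarrow> ennreal"
  assumes [measurable]: "F \<in> borel_measurable borel"
  shows "(\<integral>\<^sup>+y. F (c + y) \<partial>lborel) = (\<integral>\<^sup>+y. F y \<partial>lborel)"
  by (subst (2) lborel_distr_plus[of c, symmetric], subst nn_integral_distr) auto

lemma emeasure_disc:
  "0 \<le> r \<Longrightarrow> emeasure lborel (ball (c::complex) r) = ennreal (pi * r\<^sup>2)"
  by (simp add: emeasure_ball unit_ball_vol_2)

lemma emeasure_cdisc:
  "0 \<le> r \<Longrightarrow> emeasure lborel (cball (c::complex) r) = ennreal (pi * r\<^sup>2)"
  by (simp add: emeasure_cball unit_ball_vol_2)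

text \<open>Lebesgue measure and its rotated copy are both translation invariant; evaluating
  \<open>\<integral>\<integral> F (x + u y) 1\<^bsub>B\<^esub>(x)\<close> in both orders, with \<open>B\<close> the unit disc, shows that they agree.\<close>

lemma nn_integral_lborel_rotate:
  fixes F :: "complex \<Rightarrow> ennreal"
  assumes [measurable]: "F \<in> borel_measurable borel" and u: "norm u = 1"
  shows "(\<integral>\<^sup>+y. F (u * y) \<partial>lborel) = (\<integral>\<^sup>+y. F y \<partial>lborel)"
proof -
  define B where "B = (\<lambda>x::complex. indicator (ball 0 1) x :: ennreal)"
  have [measurable]: "B \<in> borel_measurable borel" by (auto simp: B_def intro!: borel_measurable_indicator)
  have IB: "(\<integral>\<^sup>+x. B x \<partial>lborel) = ennreal pi" by (simp add: B_def emeasure_disc)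
  have "u \<noteq> 0" using u by auto
  have [measurable]: "(\<lambda>y. F (u * y)) \<in> borel_measurable borel" by simp
  have "(\<integral>\<^sup>+x. \<integral>\<^sup>+y. F (x + u * y) * B x \<partial>lborel \<partial>lborel)
      = (\<integral>\<^sup>+x. (\<integral>\<^sup>+y. F (u * (x / u + y)) \<partial>lborel) * B x \<partial>lborel)"
    using \<open>u \<noteq> 0\<close> by (simp add: nn_integral_multc distrib_left)
  also have "\<dots> = (\<integral>\<^sup>+y. F (u * y) \<partial>lborel) * pi"
    by (subst nn_integral_lborel_shift) (auto simp: nn_integral_cmult IB)
  finally have 1: "(\<integral>\<^sup>+x. \<integral>\<^sup>+y. F (x + u * y) * B x \<partial>lborel \<partial>lborel) = (\<integral>\<^sup>+y. F (u * y) \<partial>lborel) * pi" .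
  have "(\<integral>\<^sup>+x. \<integral>\<^sup>+y. F (x + u * y) * B x \<partial>lborel \<partial>lborel)
      = (\<integral>\<^sup>+y. \<integral>\<^sup>+x. F (u * y + x) * B (x + u * y - u * y) \<partial>lborel \<partial>lborel)"
    by (subst lborel_pair.Fubini') (auto simp: add.commute)
  also have "\<dots> = (\<integral>\<^sup>+y. \<integral>\<^sup>+x. F x * B (x - u * y) \<partial>lborel \<partial>lborel)"
    using nn_integral_lborel_shift[of "\<lambda>x. F x * B (x - u * y)" "u * y" for y]
    by (simp add: add.commute)
  also have "\<dots> = (\<integral>\<^sup>+x. \<integral>\<^sup>+y. F x * B (x - u * y) \<partial>lborel \<partial>lborel)"
    by (subst lborel_pair.Fubini') auto
  also have "\<dots> = (\<integral>\<^sup>+x. F x * (\<integral>\<^sup>+y. indicator (ball (x / u) 1) y \<partial>lborel) \<partial>lborel)"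
  proof -
    have "norm (x - u * y) = norm (x / u - y)" for x y
    proof -
      have "x - u * y = u * (x / u - y)" using \<open>u \<noteq> 0\<close> by (simp add: algebra_simps)
      then show ?thesis using u by (metis mult_1 norm_mult)
    qed
    then show ?thesis
      by (simp add: nn_integral_cmult B_def indicator_def dist_norm)
  qed
  also have "\<dots> = (\<integral>\<^sup>+y. F y \<partial>lborel) * pi"
    by (simp add: nn_integral_multc emeasure_disc)
  finally have "(\<integral>\<^sup>+y. F (u * y) \<partial>lborel) * pi = (\<integral>\<^sup>+y. F y \<partial>lborel) * pi"
    using 1 by simp
  then show ?thesis
    by (auto simp: mult.commute[of _ "ennreal pi"] ennreal_mult_cancel_left)
qed

text \<open>Cauchy's formula at the centre: the kernel 1/u cancels against the derivative of the
  parametrisation and leaves a plain mean. The unit circle is enough, since the use below is for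
  \<zeta> \<mapsto> h(z + \<zeta> w), which rescales and rotates it.\<close>

lemma norm_le_nn_integral_circle:
  assumes "k holomorphic_on cball 0 1"
  shows "ennreal (norm (k 0)) \<le> (\<integral>\<^sup>+t\<in>{0..1}. ennreal (norm (k (exp (2 * of_real pi * \<i> * of_real t)))) \<partial>lborel)"
proof -
  let ?e = "\<lambda>t::real. exp (2 * of_real pi * \<i> * of_real t)"
  have "((\<lambda>u. k u / (u - 0)) has_contour_integral 2 * of_real pi * \<i> * k 0) (circlepath 0 1)"
    by (rule Cauchy_integral_circlepath_simple) (use assms in auto)
  then have "((\<lambda>t. 2 * pi * \<i> * k (?e t)) has_integral 2 * of_real pi * \<i> * k 0) {0..1}"
    unfolding has_contour_integral vector_derivative_circlepath
    by (simp add: circlepath mult_ac)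
  then have "((\<lambda>t. (1 / (2 * pi * \<i>)) * (2 * pi * \<i> * k (?e t))) has_integral (1 / (2 * pi * \<i>)) * (2 * of_real pi * \<i> * k 0)) {0..1}"
    by (rule has_integral_mult_right)
  then have 1: "((\<lambda>t. k (?e t)) has_integral k 0) {0..1}" by simp
  have c: "continuous_on {0..1} (\<lambda>t. k (?e t))"
    by (rule continuous_on_compose2[OF holomorphic_on_imp_continuous_on[OF assms]])
       (auto intro!: continuous_intros simp: norm_mult)
  then have 2: "(\<lambda>t. norm (k (?e t))) integrable_on {0..1}"
    by (intro integrable_continuous_interval continuous_on_norm)
  have "norm (k 0) \<le> integral {0..1} (\<lambda>t. norm (k (?e t)))"
    using integral_norm_bound_integral[OF has_integral_integrable[OF 1] 2] by (simp add: integral_unique[OF 1])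
  also have "ennreal \<dots> = (\<integral>\<^sup>+t\<in>{0..1}. ennreal (norm (k (?e t))) \<partial>lborel)"
    by (subst nn_integral_has_integral_lebesgue'[OF _ integrable_integral[OF 2]]) auto
  finally show ?thesis by (simp add: ennreal_leI)
qed

text \<open>Holomorphic functions are controlled on their domain only and arbitrary elsewhere, so
  measurability is available for the cut-off product alone.\<close>

lemma borel_measurable_ennreal_indicator:
  fixes f :: "'a::topological_space \<Rightarrow> real"
  assumes "continuous_on A f" "A \<in> sets borel"
  shows "(\<lambda>x. ennreal (f x) * indicator A x) \<in> borel_measurable borel"
proof -
  have "(\<lambda>x. ennreal (f x) * indicator A x) = (\<lambda>x. ennreal (indicator A x *\<^sub>R f x))"
    by (auto simp: indicator_def)
  also have "\<dots> \<in> borel_measurable borel"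
    using borel_measurable_continuous_on_indicator[OF assms(2,1)] by measurable
  finally show ?thesis .
qed

text \<open>Each w in the disc about 0 gives a circle through z + w on which the mean of |h| is at
  least |h(z)|. Integrating over w and exchanging the order, rotation and translation invariance
  make the inner integral independent of the angle, so this replaces polar coordinates.\<close>

lemma submean_value:
  assumes holo: "h holomorphic_on ball z r" and "0 < r"
  shows "ennreal (norm (h z) * (pi * r\<^sup>2)) \<le> (\<integral>\<^sup>+w\<in>ball z r. ennreal (norm (h w)) \<partial>lborel)"
proof -
  define H where "H = (\<lambda>w. ennreal (norm (h w)) * indicator (ball z r) w)"
  define e where "e = (\<lambda>t::real. exp (2 * of_real pi * \<i> * of_real t))"
  have [measurable]: "H \<in> borel_measurable borel" unfolding H_def
    by (intro borel_measurable_ennreal_indicator continuous_on_norm holomorphic_on_imp_continuous_on holo) auto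
  have [measurable]: "e \<in> borel_measurable borel" unfolding e_def
    by (intro borel_measurable_continuous_onI continuous_intros)
  have ne: "norm (e t) = 1" for t by (simp add: e_def)
  have pw: "ennreal (norm (h z)) * indicator (ball 0 r) w \<le> (\<integral>\<^sup>+t\<in>{0..1}. H (z + e t * w) \<partial>lborel)" for w
  proof (cases "w \<in> ball 0 r")
    case True
    have im: "z + \<zeta> * w \<in> ball z r" if "norm \<zeta> \<le> 1" for \<zeta>
    proof -
      have "norm (\<zeta> * w) \<le> 1 * norm w" unfolding norm_mult using that by (intro mult_right_mono) auto
      with True show ?thesis by (simp add: dist_norm)
    qed
    have "(\<lambda>\<zeta>. h (z + \<zeta> * w)) holomorphic_on cball 0 1"
      by (rule holomorphic_on_compose_gen[OF _ holo, unfolded o_def])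
         (use im in \<open>auto intro!: holomorphic_intros\<close>)
    from norm_le_nn_integral_circle[OF this]
    have "ennreal (norm (h z)) \<le> (\<integral>\<^sup>+t\<in>{0..1}. ennreal (norm (h (z + e t * w))) \<partial>lborel)"
      by (simp add: e_def)
    also have "\<dots> = (\<integral>\<^sup>+t\<in>{0..1}. H (z + e t * w) \<partial>lborel)"
      using im[OF eq_refl[OF ne]] by (simp add: H_def)
    finally show ?thesis using True by simp
  qed auto
  have "ennreal (norm (h z) * (pi * r\<^sup>2)) = (\<integral>\<^sup>+w. ennreal (norm (h z)) * indicator (ball (0::complex) r) w \<partial>lborel)"
    using \<open>0 < r\<close> by (subst nn_integral_cmult_indicator) (auto simp: emeasure_disc ennreal_mult)
  also have "\<dots> \<le> (\<integral>\<^sup>+w. (\<integral>\<^sup>+t\<in>{0..1}. H (z + e t * w) \<partial>lborel) \<partial>lborel)"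
    by (intro nn_integral_mono pw)
  also have "\<dots> = (\<integral>\<^sup>+t. \<integral>\<^sup>+w. H (z + e t * w) * indicator {0..1} t \<partial>lborel \<partial>lborel)"
    by (subst lborel_pair.Fubini') auto
  also have "\<dots> = (\<integral>\<^sup>+t. (\<integral>\<^sup>+w. H w \<partial>lborel) * indicator {0..1::real} t \<partial>lborel)"
  proof -
    have "(\<integral>\<^sup>+w. H (z + e t * w) \<partial>lborel) = (\<integral>\<^sup>+w. H w \<partial>lborel)" for t
      using nn_integral_lborel_rotate[of "\<lambda>w. H (z + w)" "e t"] nn_integral_lborel_shift[of H z] ne by simp
    then show ?thesis by (simp add: nn_integral_multc)
  qed
  also have "\<dots> = (\<integral>\<^sup>+w. H w \<partial>lborel)" by (simp add: nn_integral_cmult)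
  finally show ?thesis by (simp add: H_def)
qed

text \<open>Hoelder's inequality against the indicator of the disc. With V the area, the left side
  carries \<open>V powr p\<close> and the right side \<open>V powr (p - 1)\<close>, so one factor V
  remains.\<close>

lemma submean_value_powr:
  assumes holo: "h holomorphic_on ball z r" and "0 < r" and "1 < p"
  shows "ennreal (norm (h z) powr p * (pi * r\<^sup>2)) \<le> (\<integral>\<^sup>+w\<in>ball z r. ennreal (norm (h w) powr p) \<partial>lborel)"
proof -
  define V where "V = pi * r\<^sup>2"
  have "V > 0" using \<open>0 < r\<close> by (simp add: V_def)
  define q where "q = p / (p - 1)"
  have pq: "1 / p + 1 / q = 1" using \<open>1 < p\<close> by (simp add: q_def field_simps)
  define u where "u = (\<lambda>w. indicator (ball z r) w *\<^sub>R norm (h w))"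
  have [measurable]: "u \<in> borel_measurable borel" unfolding u_def
    by (intro borel_measurable_continuous_on_indicator continuous_on_norm holomorphic_on_imp_continuous_on holo) auto
  define v where "v = (\<lambda>w. indicator (ball z r) w :: real)"
  have [measurable]: "v \<in> borel_measurable borel" by (auto simp: v_def intro!: borel_measurable_indicator)
  have "ennreal ((norm (h z) * V) powr p) \<le> ennreal (V powr (p - 1)) * (\<integral>\<^sup>+x. ennreal (u x powr p) \<partial>lborel)"
  proof (rule holder_nn_integral_powr[OF \<open>1 < p\<close> pq \<open>V > 0\<close>, where v = v])
    have "(\<integral>\<^sup>+w\<in>ball z r. ennreal (norm (h w)) \<partial>lborel) = (\<integral>\<^sup>+x. ennreal (u x * v x) \<partial>lborel)"
      by (intro nn_integral_cong) (auto simp: u_def v_def indicator_def)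
    then show "ennreal (norm (h z) * V) \<le> (\<integral>\<^sup>+x. ennreal (u x * v x) \<partial>lborel)"
      using submean_value[OF holo \<open>0 < r\<close>] by (simp add: V_def)
    have "(\<integral>\<^sup>+x. ennreal (v x powr q) \<partial>lborel) = (\<integral>\<^sup>+x. indicator (ball z r) x \<partial>lborel)"
      by (intro nn_integral_cong) (auto simp: v_def indicator_def)
    then show "(\<integral>\<^sup>+x. ennreal (v x powr q) \<partial>lborel) \<le> ennreal V"
      using \<open>0 < r\<close> by (simp add: emeasure_disc V_def)
    show "u \<in> borel_measurable lborel" "v \<in> borel_measurable lborel" by measurable
  qed (use \<open>V > 0\<close> in \<open>auto simp: u_def v_def\<close>)
  also have "(\<integral>\<^sup>+x. ennreal (u x powr p) \<partial>lborel) = (\<integral>\<^sup>+w\<in>ball z r. ennreal (norm (h w) powr p) \<partial>lborel)"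
    by (intro nn_integral_cong) (auto simp: u_def indicator_def)
  also have "(norm (h z) * V) powr p = V powr (p - 1) * (norm (h z) powr p * V)"
    using \<open>V > 0\<close> by (simp add: powr_mult powr_diff)
  finally have "ennreal (V powr (p - 1)) * ennreal (norm (h z) powr p * V)
     \<le> ennreal (V powr (p - 1)) * (\<integral>\<^sup>+w\<in>ball z r. ennreal (norm (h w) powr p) \<partial>lborel)"
    using \<open>V > 0\<close> by (simp add: ennreal_mult)
  then show ?thesis
    using \<open>V > 0\<close> by (subst (asm) ennreal_mult_le_mult_iff) (auto simp: V_def)
qed

text \<open>Discs of radius r/2 about points of the circle |x - z| = r/2 stay inside the given disc,
  so the previous inequality bounds |h|^p on that circle by 4 / (pi r^2) times the integral.
  Cauchy's estimate then adds the factor (2/r)^p.\<close>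

lemma submean_value_deriv_powr:
  assumes holo: "h holomorphic_on ball z r" and "0 < r" and "1 < p"
  shows "ennreal (norm (deriv h z) powr p) \<le>
     ennreal (2 powr p * 4 / pi * r powr (- p - 2)) * (\<integral>\<^sup>+w\<in>ball z r. ennreal (norm (h w) powr p) \<partial>lborel)"
proof (cases "(\<integral>\<^sup>+w\<in>ball z r. ennreal (norm (h w) powr p) \<partial>lborel) = \<infinity>")
  case True
  then show ?thesis using \<open>0 < r\<close> by (simp add: ennreal_mult_eq_top_iff ennreal_mult_top)
next
  case False
  then obtain I where I: "(\<integral>\<^sup>+w\<in>ball z r. ennreal (norm (h w) powr p) \<partial>lborel) = ennreal I" "0 \<le> I"
    by (cases "(\<integral>\<^sup>+w\<in>ball z r. ennreal (norm (h w) powr p) \<partial>lborel)") auto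
  define c where "c = 4 / (pi * r\<^sup>2)"
  have "c > 0" using \<open>0 < r\<close> by (simp add: c_def)
  have bd: "norm (h x) \<le> (c * I) powr (1 / p)" if "norm (z - x) = r / 2" for x
  proof -
    have sub: "ball x (r/2) \<subseteq> ball z r"
    proof
      fix y assume "y \<in> ball x (r/2)"
      then show "y \<in> ball z r" using dist_triangle[of z y x] that by (simp add: dist_norm)
    qed
    have "ennreal (norm (h x) powr p * (pi * (r/2)\<^sup>2)) \<le> (\<integral>\<^sup>+w\<in>ball x (r/2). ennreal (norm (h w) powr p) \<partial>lborel)"
      by (rule submean_value_powr) (use holo holomorphic_on_subset sub \<open>0 < r\<close> \<open>1 < p\<close> in auto)
    also have "\<dots> \<le> ennreal I" unfolding I(1)[symmetric]
      using sub by (intro nn_integral_mono mult_left_mono) (auto simp: indicator_def)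
    finally have "norm (h x) powr p * (pi * (r/2)\<^sup>2) \<le> I" using I(2) by simp
    then have "norm (h x) powr p \<le> c * I" using \<open>0 < r\<close> by (simp add: c_def field_simps power2_eq_square)
    then have "(norm (h x) powr p) powr (1 / p) \<le> (c * I) powr (1 / p)"
      using \<open>1 < p\<close> by (intro powr_mono2) auto
    then show ?thesis using \<open>1 < p\<close> by (simp add: powr_powr)
  qed
  have "cball z (r/2) \<subseteq> ball z r" using \<open>0 < r\<close> by auto
  then have "norm ((deriv ^^ 1) h z) \<le> fact 1 * (c * I) powr (1 / p) / (r / 2) ^ 1"
    using \<open>0 < r\<close> bd holo ball_subset_cball
    by (intro Cauchy_inequality) (auto intro: holomorphic_on_subset holomorphic_on_imp_continuous_on)
  then have "norm (deriv h z) \<le> (c * I) powr (1 / p) * (2 / r)" by simp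
  then have "norm (deriv h z) powr p \<le> ((c * I) powr (1 / p) * (2 / r)) powr p"
    using \<open>1 < p\<close> by (intro powr_mono2) auto
  also have "\<dots> = c * I * (2 / r) powr p"
    using \<open>1 < p\<close> I(2) \<open>c > 0\<close> \<open>0 < r\<close> by (subst powr_mult) (auto simp: powr_powr)
  also have "\<dots> = 2 powr p * 4 / pi * r powr (- p - 2) * I"
    using \<open>0 < r\<close> by (simp add: c_def powr_divide powr_minus powr_diff field_simps)
  finally show ?thesis using I \<open>0 < r\<close> by (simp flip: ennreal_mult add: ennreal_leI)
qed

subsection \<open>Oscillation along John curves\<close>

lemma bdist_triangle: "bdist \<Omega> x \<le> bdist \<Omega> y + dist x y"
  by (simp add: bdist_def infdist_triangle)

lemma continuous_on_bdist [continuous_intros]: "continuous_on S f \<Longrightarrow> continuous_on S (\<lambda>x. bdist \<Omega> (f x))"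
  unfolding bdist_def by (intro continuous_intros)

lemma borel_measurable_bdist [measurable]: "bdist \<Omega> \<in> borel_measurable borel"
  by (intro borel_measurable_continuous_onI continuous_on_bdist continuous_on_id)

text \<open>The frontier must be nonempty because \<open>infdist z {}\<close> has the default value
  0.\<close>

lemma bdist_pos:
  assumes "open \<Omega>" "frontier \<Omega> \<noteq> {}" "z \<in> \<Omega>"
  shows "0 < bdist \<Omega> z"
  unfolding bdist_def
  by (rule infdist_pos_not_in_closed) (use assms in \<open>auto simp: frontier_def interior_open\<close>)

text \<open>A ball is connected, so if it met both \<Omega> and the complement it would contain a
  frontier point, closer to z than the distance to the frontier.\<close>

lemma ball_bdist_subset:
  assumes "z \<in> \<Omega>" "r \<le> bdist \<Omega> z"
  shows "ball z r \<subseteq> \<Omega>"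
proof (rule ccontr)
  assume "\<not> ball z r \<subseteq> \<Omega>"
  then have "ball z r - \<Omega> \<noteq> {}" by auto
  then have "0 < r" by (auto intro: le_less_trans[OF zero_le_dist])
  then have "z \<in> ball z r \<inter> \<Omega>" using assms(1) by simp
  with \<open>ball z r - \<Omega> \<noteq> {}\<close> have "ball z r \<inter> frontier \<Omega> \<noteq> {}"
    by (intro connected_Int_frontier connected_ball) blast+
  then obtain y where "y \<in> frontier \<Omega>" "dist z y < r" by auto
  then show False using infdist_le[of y "frontier \<Omega>" z] assms(2) by (simp add: bdist_def)
qed

lemma john_domainD:
  assumes "john_domain \<Omega>"
  shows "open \<Omega>" "bounded \<Omega>" "frontier \<Omega> \<noteq> {}"
  using assms not_bounded_UNIV[where 'a = complex] by (auto simp: john_domain_def frontier_eq_empty)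

text \<open>Any inscribed polygon over [0, s], prolonged by the chord from \<gamma>(s) to
  \<gamma>(t), is inscribed over [0, t]. Hence the length s plus the chord is at most the length t.
  This Lipschitz bound is the form in which arclength is used from here on.\<close>

lemma arclength_param_dist_le:
  assumes "arclength_param \<gamma> l" "0 \<le> s" "s \<le> t" "t \<le> l"
  shows "dist (\<gamma> s) (\<gamma> t) \<le> t - s"
proof -
  have len: "curve_length \<gamma> 0 s = ennreal s" "curve_length \<gamma> 0 t = ennreal t"
    using assms by (auto simp: arclength_param_def)
  define d where "d = dist (\<gamma> s) (\<gamma> t)"
  have *: "(\<Sum>i<n. dist (\<gamma> (\<tau> i)) (\<gamma> (\<tau> (Suc i)))) + d \<le> t"
    if \<tau>: "mono_on {..n} \<tau>" "\<tau> ` {..n} \<subseteq> {0..s}" for n and \<tau> :: "nat \<Rightarrow> real"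
  proof -
    \<comment> \<open>The node \<open>s\<close> is inserted because \<open>\<tau> n\<close> may fall
      short of it: the segment up to \<open>s\<close> only adds length, and the last segment is
      exactly the chord \<open>d\<close>.\<close>
    define \<sigma> where "\<sigma> = (\<lambda>i. if i \<le> n then \<tau> i else if i = Suc n then s else t)"
    have rng: "\<tau> i \<in> {0..s}" if "i \<le> n" for i using that \<tau>(2) by auto
    have "mono_on {..Suc (Suc n)} \<sigma>"
      using \<tau>(1) rng assms(3) by (fastforce simp: mono_on_def \<sigma>_def)
    moreover have "\<sigma> ` {..Suc (Suc n)} \<subseteq> {0..t}"
      using rng assms(2,3) by (force simp: \<sigma>_def)
    ultimately have "(\<Sum>i<Suc (Suc n). ennreal (dist (\<gamma> (\<sigma> i)) (\<gamma> (\<sigma> (Suc i))))) \<le> curve_length \<gamma> 0 t"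
      unfolding curve_length_def by (intro SUP_upper2[of "(Suc (Suc n), \<sigma>)"]) (auto simp del: sum.lessThan_Suc)
    then have "(\<Sum>i<Suc (Suc n). dist (\<gamma> (\<sigma> i)) (\<gamma> (\<sigma> (Suc i)))) \<le> t"
      using assms(2,3) by (subst (asm) sum_ennreal) (auto simp: len)
    moreover have "(\<Sum>i<n. dist (\<gamma> (\<sigma> i)) (\<gamma> (\<sigma> (Suc i)))) = (\<Sum>i<n. dist (\<gamma> (\<tau> i)) (\<gamma> (\<tau> (Suc i))))"
      by (intro sum.cong) (auto simp: \<sigma>_def)
    moreover have "dist (\<gamma> (\<sigma> (Suc n))) (\<gamma> (\<sigma> (Suc (Suc n)))) = d"
      by (simp add: \<sigma>_def d_def)
    moreover have "0 \<le> dist (\<gamma> (\<sigma> n)) (\<gamma> (\<sigma> (Suc n)))" by simp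
    ultimately show ?thesis unfolding sum.lessThan_Suc by linarith
  qed
  \<comment> \<open>The one-point partition gives \<open>d \<le> t\<close>, without which
    \<open>ennreal (t - d)\<close> would be truncated to 0.\<close>
  have "mono_on {..0::nat} (\<lambda>_. 0::real)" by (simp add: mono_on_def)
  from *[OF this] have "d \<le> t" using assms(2) by simp
  have "curve_length \<gamma> 0 s \<le> ennreal (t - d)"
    unfolding curve_length_def
  proof (intro SUP_least, clarify)
    fix n and \<tau> :: "nat \<Rightarrow> real"
    assume "mono_on {..n} \<tau>" "\<tau> ` {..n} \<subseteq> {0..s}"
    from *[OF this] show "(\<Sum>i<n. ennreal (dist (\<gamma> (\<tau> i)) (\<gamma> (\<tau> (Suc i))))) \<le> ennreal (t - d)"
      by (subst sum_ennreal) (auto intro: ennreal_leI)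
  qed
  then show ?thesis using \<open>d \<le> t\<close> assms(2) by (simp add: len d_def)
qed

text \<open>The curve is merely Lipschitz and its derivative is not at hand, so the chain rule is
  replaced by a bisection argument: an inequality that is additive over adjacent intervals and true
  on all short intervals around each point holds on the whole interval.\<close>

lemma norm_diff_le_integral_deriv:
  assumes "open S" "g holomorphic_on S" "0 \<le> l"
    and S: "\<And>t. t \<in> {0..l} \<Longrightarrow> \<gamma> t \<in> S"
    and lip: "\<And>s t. 0 \<le> s \<Longrightarrow> s \<le> t \<Longrightarrow> t \<le> l \<Longrightarrow> dist (\<gamma> s) (\<gamma> t) \<le> t - s"
    and cont: "continuous_on {0..l} \<gamma>"
  shows "norm (g (\<gamma> l) - g (\<gamma> 0)) \<le> integral {0..l} (\<lambda>t. norm (deriv g (\<gamma> t)))"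
proof -
  define u where "u = (\<lambda>t. norm (deriv g (\<gamma> t)))"
  have cu: "continuous_on {0..l} u" unfolding u_def
    by (intro continuous_on_norm continuous_on_compose2[OF holomorphic_on_imp_continuous_on[OF holomorphic_deriv[OF assms(2,1)]] cont])
       (use S in auto)
  have iu: "u integrable_on {a..b}" if "0 \<le> a" "b \<le> l" for a b
    using cu that by (intro integrable_continuous_interval continuous_on_subset[OF cu]) auto
  have main: "norm (g (\<gamma> l) - g (\<gamma> 0)) \<le> integral {0..l} u + 2 * e * (l - 0)" if "0 < e" for e
  proof -
    \<comment> \<open>The slack is \<open>2 * e\<close> per unit length: one \<open>e\<close> for
      the linearisation error of \<open>g\<close> at \<open>\<gamma> x\<close>, one for the
      oscillation of \<open>u\<close> near \<open>x\<close>. Being proportional to length, it adds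
      up under concatenation.\<close>
    define P where "P = (\<lambda>a b. 0 \<le> a \<and> b \<le> l \<longrightarrow> norm (g (\<gamma> b) - g (\<gamma> a)) \<le> integral {a..b} u + 2 * e * (b - a))"
    have "P 0 l"
    proof (rule Bolzano[OF \<open>0 \<le> l\<close>])
      fix a b c :: real
      assume h: "P a b" "P b c" "a \<le> b" "b \<le> c"
      show "P a c" unfolding P_def
      proof
        assume ac: "0 \<le> a \<and> c \<le> l"
        have "integral {a..b} u + integral {b..c} u = integral {a..c} u"
          using h ac by (intro Henstock_Kurzweil_Integration.integral_combine iu) auto
        moreover have "norm (g (\<gamma> c) - g (\<gamma> a)) \<le> norm (g (\<gamma> c) - g (\<gamma> b)) + norm (g (\<gamma> b) - g (\<gamma> a))"
          using norm_triangle_ineq[of "g (\<gamma> c) - g (\<gamma> b)" "g (\<gamma> b) - g (\<gamma> a)"] by simp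
        ultimately show "norm (g (\<gamma> c) - g (\<gamma> a)) \<le> integral {a..c} u + 2 * e * (c - a)"
          using h ac by (auto simp: P_def algebra_simps)
      qed
    next
      fix x assume x: "0 \<le> x" "x \<le> l"
      have "(g has_field_derivative deriv g (\<gamma> x)) (at (\<gamma> x))"
        using assms(1,2) S x by (simp add: holomorphic_derivI)
      then have "(g has_derivative (*) (deriv g (\<gamma> x))) (at (\<gamma> x))"
        by (simp add: has_field_derivative_def)
      then obtain d1 where d1: "0 < d1" "\<And>y. norm (y - \<gamma> x) < d1 \<Longrightarrow>
          norm (g y - g (\<gamma> x) - deriv g (\<gamma> x) * (y - \<gamma> x)) \<le> e * norm (y - \<gamma> x)"
        unfolding has_derivative_at_alt using \<open>0 < e\<close> by blast
      have d1': "norm (g y - g (\<gamma> x)) \<le> (u x + e) * norm (y - \<gamma> x)" if "norm (y - \<gamma> x) < d1" for y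
      proof -
        have "norm (g y - g (\<gamma> x)) \<le> norm (g y - g (\<gamma> x) - deriv g (\<gamma> x) * (y - \<gamma> x)) + norm (deriv g (\<gamma> x) * (y - \<gamma> x))"
          using norm_triangle_ineq[of "g y - g (\<gamma> x) - deriv g (\<gamma> x) * (y - \<gamma> x)" "deriv g (\<gamma> x) * (y - \<gamma> x)"] by simp
        also have "\<dots> \<le> e * norm (y - \<gamma> x) + u x * norm (y - \<gamma> x)"
          by (rule add_mono[OF d1(2)[OF that]]) (simp add: u_def norm_mult)
        finally show ?thesis by (simp add: algebra_simps)
      qed
      obtain d2 where d2: "0 < d2" "\<And>t. t \<in> {0..l} \<Longrightarrow> dist t x < d2 \<Longrightarrow> dist (u t) (u x) < e"
        using cu x \<open>0 < e\<close> unfolding continuous_on_iff by (metis atLeastAtMost_iff)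
      have ux: "0 \<le> u x" by (simp add: u_def)
      show "\<exists>d>0. \<forall>a b. a \<le> x \<and> x \<le> b \<and> b - a < d \<longrightarrow> P a b"
      proof (intro exI[of _ "min d1 d2"] conjI allI impI)
        show "0 < min d1 d2" using d1 d2 by simp
        fix a b assume ab: "a \<le> x \<and> x \<le> b \<and> b - a < min d1 d2"
        show "P a b" unfolding P_def
        proof
          assume h: "0 \<le> a \<and> b \<le> l"
          have n: "norm (\<gamma> b - \<gamma> x) \<le> b - x" "norm (\<gamma> a - \<gamma> x) \<le> x - a"
            using lip[of x b] lip[of a x] ab h x by (auto simp: dist_norm norm_minus_commute)
          have "norm (g (\<gamma> b) - g (\<gamma> a)) \<le> norm (g (\<gamma> b) - g (\<gamma> x)) + norm (g (\<gamma> a) - g (\<gamma> x))"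
            using norm_triangle_ineq4[of "g (\<gamma> b) - g (\<gamma> x)" "g (\<gamma> a) - g (\<gamma> x)"] by simp
          also have "\<dots> \<le> (u x + e) * norm (\<gamma> b - \<gamma> x) + (u x + e) * norm (\<gamma> a - \<gamma> x)"
            using n ab by (intro add_mono d1') auto
          also have "\<dots> \<le> (u x + e) * (b - x) + (u x + e) * (x - a)"
            using n ux \<open>0 < e\<close> by (intro add_mono mult_left_mono) auto
          finally have 1: "norm (g (\<gamma> b) - g (\<gamma> a)) \<le> (u x + e) * (b - a)" by (simp add: algebra_simps)
          have "integral {a..b} (\<lambda>t. u x - e) \<le> integral {a..b} u"
          proof (rule integral_le)
            fix t assume t: "t \<in> {a..b}"
            then have "t \<in> {0..l}" "dist t x < d2" using ab h by (auto simp: dist_real_def)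
            from d2(2)[OF this] show "u x - e \<le> u t" by (simp add: dist_real_def)
          qed (use iu h in auto)
          then have "(u x - e) * (b - a) \<le> integral {a..b} u" using ab by (simp add: mult.commute)
          with 1 show "norm (g (\<gamma> b) - g (\<gamma> a)) \<le> integral {a..b} u + 2 * e * (b - a)"
            by (simp add: algebra_simps)
        qed
      qed
    qed
    with \<open>0 \<le> l\<close> show ?thesis by (simp add: P_def)
  qed
  have "norm (g (\<gamma> l) - g (\<gamma> 0)) \<le> integral {0..l} u + e" if "0 < e" for e
  proof -
    \<comment> \<open>The summand 1 in the denominator covers the degenerate curve
      \<open>l = 0\<close>.\<close>
    have "2 * (e / (2 * (l + 1))) * (l - 0) \<le> e"
      using that \<open>0 \<le> l\<close> by (simp add: divide_simps)
    with main[of "e / (2 * (l + 1))"] that \<open>0 \<le> l\<close> show ?thesis by (smt (verit) divide_pos_pos)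
  qed
  then show ?thesis unfolding u_def by (rule field_le_epsilon)
qed

text \<open>At time t the value |g'| is replaced by its mean over the disc of radius \<delta>/2
  about the curve point. After exchanging the integrals, a fixed w is seen only for t \<le> 2
  \<delta>(w) / C, by the John condition; this time span cancels one power of the mean's
  \<delta>(w)^(-2). The constant is 9/pi times 2/C.\<close>

lemma norm_diff_le_shadow_integral:
  assumes \<Omega>: "open \<Omega>" "frontier \<Omega> \<noteq> {}" and holo: "g holomorphic_on \<Omega>" and "0 \<le> l" "0 < C"
    and \<gamma>: "\<And>t. t \<in> {0..l} \<Longrightarrow> \<gamma> t \<in> \<Omega>"
    and lip: "\<And>s t. 0 \<le> s \<Longrightarrow> s \<le> t \<Longrightarrow> t \<le> l \<Longrightarrow> dist (\<gamma> s) (\<gamma> t) \<le> t - s"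
    and cont: "continuous_on {0..l} \<gamma>"
    and john: "\<And>t. t \<in> {0..l} \<Longrightarrow> C * t \<le> bdist \<Omega> (\<gamma> t)"
  shows "ennreal (norm (g (\<gamma> l) - g (\<gamma> 0)))
    \<le> (\<integral>\<^sup>+w\<in>{w\<in>\<Omega>. dist (\<gamma> 0) w \<le> (2 / C + 1) * bdist \<Omega> w}.
          ennreal (18 / (pi * C) * norm (deriv g w) / bdist \<Omega> w) \<partial>lborel)"
proof -
  have [measurable]: "\<Omega> \<in> sets borel" using \<Omega> by auto
  have holo': "deriv g holomorphic_on \<Omega>" by (rule holomorphic_deriv[OF holo \<Omega>(1)])
  define G where "G = (\<lambda>w. ennreal (norm (deriv g w)) * indicator \<Omega> w)"
  have [measurable]: "G \<in> borel_measurable borel" unfolding G_def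
    by (intro borel_measurable_ennreal_indicator continuous_on_norm holomorphic_on_imp_continuous_on holo') auto
  \<comment> \<open>The curve is frozen outside [0, l] to obtain a Borel function on the whole
    line.\<close>
  define \<Gamma> where "\<Gamma> = (\<lambda>t. \<gamma> (max 0 (min t l)))"
  have "continuous_on UNIV \<Gamma>" unfolding \<Gamma>_def
    by (rule continuous_on_compose2[OF cont]) (use \<open>0 \<le> l\<close> in \<open>auto intro!: continuous_intros\<close>)
  then have [measurable]: "\<Gamma> \<in> borel_measurable borel" by (rule borel_measurable_continuous_onI)
  have \<Gamma>_eq: "\<Gamma> t = \<gamma> t" if "t \<in> {0..l}" for t using that by (simp add: \<Gamma>_def)
  define D where "D = (\<lambda>t. bdist \<Omega> (\<Gamma> t))"
  have [measurable]: "D \<in> borel_measurable borel" unfolding D_def by measurable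
  have Dpos: "0 < D t" if "t \<in> {0..l}" for t
    using bdist_pos[OF \<Omega> \<gamma>[OF that]] that by (simp add: D_def \<Gamma>_eq)
  define k where "k = (\<lambda>t w. ennreal (4 / (pi * (D t)\<^sup>2)) * (if dist (\<Gamma> t) w < D t / 2 then G w else 0))"
  have [measurable]: "(\<lambda>(t, w). k t w) \<in> borel_measurable (lborel \<Otimes>\<^sub>M lborel)"
    unfolding k_def by measurable
  have sub: "ennreal (norm (deriv g (\<gamma> t))) \<le> (\<integral>\<^sup>+w. k t w \<partial>lborel)" if t: "t \<in> {0..l}" for t
  proof -
    define z where "z = \<gamma> t"
    define d where "d = D t"
    have d: "0 < d" "d = bdist \<Omega> z" using Dpos[OF t] t by (auto simp: d_def D_def z_def \<Gamma>_eq)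
    have sub: "ball z (d / 2) \<subseteq> \<Omega>" by (rule ball_bdist_subset) (use d \<gamma>[OF t] in \<open>auto simp: z_def\<close>)
    have "ennreal (norm (deriv g z) * (pi * (d / 2)\<^sup>2)) \<le> (\<integral>\<^sup>+w\<in>ball z (d / 2). ennreal (norm (deriv g w)) \<partial>lborel)"
      by (rule submean_value[OF holomorphic_on_subset[OF holo' sub]]) (use d in auto)
    also have "\<dots> = (\<integral>\<^sup>+w. (if dist z w < d / 2 then G w else 0) \<partial>lborel)"
      using sub by (intro nn_integral_cong) (auto simp: G_def indicator_def)
    finally have *: "ennreal (norm (deriv g z) * (pi * (d / 2)\<^sup>2)) \<le> (\<integral>\<^sup>+w. (if dist z w < d / 2 then G w else 0) \<partial>lborel)" .
    have "norm (deriv g z) = 4 / (pi * d\<^sup>2) * (norm (deriv g z) * (pi * (d / 2)\<^sup>2))"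
      using d(1) by (simp add: field_simps power2_eq_square)
    then have "ennreal (norm (deriv g z)) = ennreal (4 / (pi * d\<^sup>2)) * ennreal (norm (deriv g z) * (pi * (d / 2)\<^sup>2))"
      by (subst ennreal_mult[symmetric]) auto
    also have "\<dots> \<le> ennreal (4 / (pi * d\<^sup>2)) * (\<integral>\<^sup>+w. (if dist z w < d / 2 then G w else 0) \<partial>lborel)"
      by (rule mult_left_mono[OF *]) simp
    also have "\<dots> = (\<integral>\<^sup>+w. k t w \<partial>lborel)"
      using t by (subst nn_integral_cmult[symmetric]) (auto simp: k_def d_def z_def \<Gamma>_eq)
    finally show ?thesis by (simp add: z_def)
  qed
  define W where "W = {w\<in>\<Omega>. dist (\<gamma> 0) w \<le> (2 / C + 1) * bdist \<Omega> w}"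
  \<comment> \<open>Where \<open>k\<close> is nonzero, d = \<open>D t\<close> and b = \<delta>(w)
    satisfy d \<le> 2 b and b \<le> 3/2 d. The first, with C t \<le> d, confines t to [0, 2 b / C]
    and puts w within t + d/2 \<le> (2/C + 1) b of the starting point; the second replaces 4 / (pi
    d^2) by 9 / (pi b^2).\<close>
  have pw: "k t w * indicator {0..l} t
      \<le> ennreal (9 / (pi * (bdist \<Omega> w)\<^sup>2)) * G w * indicator W w * indicator {0..2 * bdist \<Omega> w / C} t" for t w
  proof (cases "t \<in> {0..l} \<and> w \<in> \<Omega> \<and> dist (\<Gamma> t) w < D t / 2")
    case True
    define d where "d = D t"
    define b where "b = bdist \<Omega> w"
    from True have t: "t \<in> {0..l}" and w: "w \<in> \<Omega>" and dw: "dist (\<Gamma> t) w < d / 2" by (auto simp: d_def)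
    have "0 < d" using Dpos[OF t] by (simp add: d_def)
    have "d \<le> b + dist (\<Gamma> t) w" unfolding d_def b_def D_def by (rule bdist_triangle)
    then have b1: "d \<le> 2 * b" using dw by simp
    then have "0 < b" using \<open>0 < d\<close> by simp
    have "b \<le> d + dist w (\<Gamma> t)" unfolding d_def b_def D_def by (rule bdist_triangle)
    then have b2: "b \<le> 3 / 2 * d" using dw by (simp add: dist_commute)
    have ct: "C * t \<le> d" using john[OF t] t by (simp add: d_def D_def \<Gamma>_eq)
    have tb: "t \<le> 2 * b / C" using ct b1 \<open>0 < C\<close> by (simp add: field_simps)
    have "dist (\<gamma> 0) w \<le> dist (\<gamma> 0) (\<gamma> t) + dist (\<gamma> t) w" by (rule dist_triangle)
    also have "\<dots> \<le> t + d / 2" using lip[of 0 t] t dw by (auto simp: \<Gamma>_eq)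
    also have "\<dots> \<le> (2 / C + 1) * b" using tb b1 by (simp add: algebra_simps)
    finally have wW: "w \<in> W" using w by (simp add: W_def b_def)
    have "4 / (pi * d\<^sup>2) \<le> 9 / (pi * b\<^sup>2)"
    proof -
      have "b\<^sup>2 \<le> (3 / 2 * d)\<^sup>2" using b2 \<open>0 < b\<close> by (intro power_mono) auto
      then show ?thesis using \<open>0 < b\<close> \<open>0 < d\<close> by (simp add: divide_simps power2_eq_square)
    qed
    then have "ennreal (4 / (pi * d\<^sup>2)) * G w \<le> ennreal (9 / (pi * b\<^sup>2)) * G w"
      by (intro mult_right_mono ennreal_leI) auto
    then show ?thesis using wW tb t dw by (simp add: k_def d_def b_def)
  qed (auto simp: k_def G_def)
  have "continuous_on {0..l} (\<lambda>t. norm (deriv g (\<gamma> t)))"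
    by (intro continuous_on_norm continuous_on_compose2[OF holomorphic_on_imp_continuous_on[OF holo'] cont]) (use \<gamma> in auto)
  then have int: "(\<lambda>t. norm (deriv g (\<gamma> t))) integrable_on {0..l}" by (rule integrable_continuous_interval)
  have "ennreal (norm (g (\<gamma> l) - g (\<gamma> 0))) \<le> ennreal (integral {0..l} (\<lambda>t. norm (deriv g (\<gamma> t))))"
    by (intro ennreal_leI norm_diff_le_integral_deriv[OF \<Omega>(1) holo \<open>0 \<le> l\<close> \<gamma> lip cont])
  also have "\<dots> = (\<integral>\<^sup>+t\<in>{0..l}. ennreal (norm (deriv g (\<gamma> t))) \<partial>lborel)"
    by (rule nn_integral_has_integral_lebesgue'[OF _ integrable_integral[OF int], symmetric]) auto
  also have "\<dots> \<le> (\<integral>\<^sup>+t. \<integral>\<^sup>+w. k t w * indicator {0..l} t \<partial>lborel \<partial>lborel)"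
  proof (intro nn_integral_mono)
    fix t
    show "ennreal (norm (deriv g (\<gamma> t))) * indicator {0..l} t \<le> (\<integral>\<^sup>+w. k t w * indicator {0..l} t \<partial>lborel)"
      using sub[of t] by (cases "t \<in> {0..l}") auto
  qed
  also have "\<dots> \<le> (\<integral>\<^sup>+t. \<integral>\<^sup>+w. ennreal (9 / (pi * (bdist \<Omega> w)\<^sup>2)) * G w * indicator W w * indicator {0..2 * bdist \<Omega> w / C} t \<partial>lborel \<partial>lborel)"
    by (intro nn_integral_mono pw)
  also have "\<dots> = (\<integral>\<^sup>+w. \<integral>\<^sup>+t. ennreal (9 / (pi * (bdist \<Omega> w)\<^sup>2)) * G w * indicator W w * indicator {0..2 * bdist \<Omega> w / C} t \<partial>lborel \<partial>lborel)"
    unfolding W_def indicator_def atLeastAtMost_iff mem_Collect_eq by (rule lborel_pair.Fubini'[symmetric]) measurable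
  also have "\<dots> = (\<integral>\<^sup>+w. ennreal (9 / (pi * (bdist \<Omega> w)\<^sup>2)) * G w * indicator W w * ennreal (2 * bdist \<Omega> w / C) \<partial>lborel)"
  proof (intro nn_integral_cong)
    fix w
    have "0 \<le> 2 * bdist \<Omega> w / C" using \<open>0 < C\<close> by (simp add: bdist_def infdist_nonneg)
    then show "(\<integral>\<^sup>+t. ennreal (9 / (pi * (bdist \<Omega> w)\<^sup>2)) * G w * indicator W w * indicator {0..2 * bdist \<Omega> w / C} t \<partial>lborel)
       = ennreal (9 / (pi * (bdist \<Omega> w)\<^sup>2)) * G w * indicator W w * ennreal (2 * bdist \<Omega> w / C)"
      by (subst nn_integral_cmult) auto
  qed
  also have "\<dots> = (\<integral>\<^sup>+w\<in>W. ennreal (18 / (pi * C) * norm (deriv g w) / bdist \<Omega> w) \<partial>lborel)"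
  proof (intro nn_integral_cong)
    fix w
    show "ennreal (9 / (pi * (bdist \<Omega> w)\<^sup>2)) * G w * indicator W w * ennreal (2 * bdist \<Omega> w / C)
      = ennreal (18 / (pi * C) * norm (deriv g w) / bdist \<Omega> w) * indicator W w"
    proof (cases "w \<in> W")
      case True
      then have "w \<in> \<Omega>" by (simp add: W_def)
      then have "0 < bdist \<Omega> w" by (rule bdist_pos[OF \<Omega>])
      have "ennreal (9 / (pi * (bdist \<Omega> w)\<^sup>2)) * ennreal (norm (deriv g w)) * ennreal (2 * bdist \<Omega> w / C)
         = ennreal (9 / (pi * (bdist \<Omega> w)\<^sup>2) * norm (deriv g w) * (2 * bdist \<Omega> w / C))"
        using \<open>0 < bdist \<Omega> w\<close> \<open>0 < C\<close> by (simp flip: ennreal_mult)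
      also have "9 / (pi * (bdist \<Omega> w)\<^sup>2) * norm (deriv g w) * (2 * bdist \<Omega> w / C) = 18 / (pi * C) * norm (deriv g w) / bdist \<Omega> w"
        using \<open>0 < bdist \<Omega> w\<close> \<open>0 < C\<close> by (simp add: field_simps power2_eq_square)
      finally show ?thesis using True \<open>w \<in> \<Omega>\<close> by (simp add: G_def)
    qed auto
  qed
  finally show ?thesis by (simp add: W_def)
qed

text \<open>This trades the John centre x0, which the definition chooses, for the given point z0:
  both g(x) and g(z0) are compared with g(x0), and the region belonging to z0 is absorbed into the
  one belonging to x by enlarging K.\<close>

lemma john_domain_norm_diff_le:
  assumes john: "john_domain \<Omega>" and z0: "z0 \<in> \<Omega>"
  obtains K c where "0 < K" "0 < c"
    "\<And>g x. g holomorphic_on \<Omega> \<Longrightarrow> x \<in> \<Omega> \<Longrightarrow>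
      ennreal (norm (g x - g z0)) \<le>
        (\<integral>\<^sup>+w\<in>{w\<in>\<Omega>. dist x w \<le> K * bdist \<Omega> w}. ennreal (c * norm (deriv g w) / bdist \<Omega> w) \<partial>lborel)"
proof -
  note op = john_domainD(1)[OF john] and bd = john_domainD(2)[OF john] and fr = john_domainD(3)[OF john]
  have [measurable]: "\<Omega> \<in> sets borel" using op by auto
  obtain x0 where x0\<Omega>: "x0 \<in> \<Omega>" and "\<exists>C>0. \<forall>x\<in>\<Omega>. \<exists>\<gamma> l.
        arclength_param \<gamma> l \<and> \<gamma> ` {0..l} \<subseteq> \<Omega> \<and> \<gamma> 0 = x \<and> \<gamma> l = x0 \<and>
        (\<forall>t\<in>{0..l}. C * t \<le> bdist \<Omega> (\<gamma> t))"
    using john unfolding john_domain_def by (elim conjE bexE) (rule that)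
  then obtain C where "0 < C" and curve: "\<forall>x\<in>\<Omega>. \<exists>\<gamma> l.
        arclength_param \<gamma> l \<and> \<gamma> ` {0..l} \<subseteq> \<Omega> \<and> \<gamma> 0 = x \<and> \<gamma> l = x0 \<and>
        (\<forall>t\<in>{0..l}. C * t \<le> bdist \<Omega> (\<gamma> t))"
    by (elim exE conjE) (rule that)
  note x0 = x0\<Omega> \<open>0 < C\<close>
  define K1 where "K1 = 2 / C + 1"
  define c1 where "c1 = 18 / (pi * C)"
  have pos: "0 < K1" "0 < c1" using x0(2) by (auto simp: K1_def c1_def add_pos_pos)
  have 1: "ennreal (norm (g x - g x0)) \<le>
        (\<integral>\<^sup>+w\<in>{w\<in>\<Omega>. dist x w \<le> K1 * bdist \<Omega> w}. ennreal (c1 * norm (deriv g w) / bdist \<Omega> w) \<partial>lborel)"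
    if holo: "g holomorphic_on \<Omega>" and x: "x \<in> \<Omega>" for g x
  proof -
    obtain \<gamma> l where \<gamma>: "arclength_param \<gamma> l" "\<gamma> ` {0..l} \<subseteq> \<Omega>" "\<gamma> 0 = x" "\<gamma> l = x0"
        "\<And>t. t\<in>{0..l} \<Longrightarrow> C * t \<le> bdist \<Omega> (\<gamma> t)" using bspec[OF curve x] by (elim exE conjE) (rule that, assumption+, erule (1) bspec)
    have "0 \<le> l" "continuous_on {0..l} \<gamma>" using \<gamma>(1) by (auto simp: arclength_param_def)
    then show ?thesis
      using norm_diff_le_shadow_integral[OF op fr holo _ x0(2), of l \<gamma>] \<gamma> arclength_param_dist_le[OF \<gamma>(1)]
      by (auto simp: norm_minus_commute K1_def c1_def image_subset_iff)
  qed
  obtain M where M: "\<And>x y. x \<in> \<Omega> \<Longrightarrow> y \<in> \<Omega> \<Longrightarrow> dist x y \<le> M"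
    using bounded_two_points[of \<Omega>] bd by auto
  then have "0 \<le> M" using z0 by (meson zero_le_dist order_trans)
  have \<delta>0: "0 < bdist \<Omega> z0" by (rule bdist_pos[OF op fr z0])
  \<comment> \<open>Points w of the region of z0 satisfy \<delta>(w) \<ge> \<delta>(z0) / (1 + K1),
    while |x - w| is at most M, a bound for the diameter; the second summand turns this into |x - w|
    \<le> K \<delta>(w).\<close>
  define K where "K = K1 + M * (1 + K1) / bdist \<Omega> z0"
  have KK: "K1 \<le> K" "M * (1 + K1) / bdist \<Omega> z0 \<le> K" using pos \<delta>0 \<open>0 \<le> M\<close> by (auto simp: K_def)
  show ?thesis
  proof
    show "0 < K" "0 < 2 * c1" using pos KK by auto
    fix g x assume holo: "g holomorphic_on \<Omega>" and x: "x \<in> \<Omega>"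
    define W where "W = {w\<in>\<Omega>. dist x w \<le> K * bdist \<Omega> w}"
    have [measurable]: "W \<in> sets borel" unfolding W_def by measurable
    define h where "h = (\<lambda>w. ennreal (c1 * norm (deriv g w) / bdist \<Omega> w) * indicator W w)"
    have holo': "deriv g holomorphic_on \<Omega>" using holo op by (rule holomorphic_deriv)
    have "{w\<in>\<Omega>. dist x w \<le> K1 * bdist \<Omega> w} \<subseteq> W"
      using KK bdist_pos[OF op fr] by (auto simp: W_def intro: order_trans mult_right_mono less_imp_le)
    then have a: "ennreal (norm (g x - g x0)) \<le> (\<integral>\<^sup>+w. h w \<partial>lborel)"
      by (intro order_trans[OF 1[OF holo x]] nn_integral_mono) (auto simp: h_def indicator_def)
    have "{w\<in>\<Omega>. dist z0 w \<le> K1 * bdist \<Omega> w} \<subseteq> W"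
    proof clarify
      fix w assume w: "w \<in> \<Omega>" "dist z0 w \<le> K1 * bdist \<Omega> w"
      have "bdist \<Omega> z0 \<le> bdist \<Omega> w + dist z0 w" by (rule bdist_triangle)
      then have *: "1 \<le> (1 + K1) * bdist \<Omega> w / bdist \<Omega> z0" using w \<delta>0 by (simp add: field_simps)
      have "dist x w \<le> M * 1" using M x w by simp
      also have "\<dots> \<le> M * ((1 + K1) * bdist \<Omega> w / bdist \<Omega> z0)" using * \<open>0 \<le> M\<close> by (rule mult_left_mono)
      also have "\<dots> = M * (1 + K1) / bdist \<Omega> z0 * bdist \<Omega> w" by simp
      also have "\<dots> \<le> K * bdist \<Omega> w" 
        using KK(2) bdist_pos[OF op fr w(1)] by (intro mult_right_mono) auto
      finally show "w \<in> W" using w by (simp add: W_def)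
    qed
    then have b: "ennreal (norm (g z0 - g x0)) \<le> (\<integral>\<^sup>+w. h w \<partial>lborel)"
      by (intro order_trans[OF 1[OF holo z0]] nn_integral_mono) (auto simp: h_def indicator_def)
    have "ennreal (norm (g x - g z0)) \<le> ennreal (norm (g x - g x0)) + ennreal (norm (g z0 - g x0))"
      using norm_triangle_ineq4[of "g x - g x0" "g z0 - g x0"]
      by (simp flip: ennreal_plus add: ennreal_leI)
    also have "\<dots> \<le> 2 * (\<integral>\<^sup>+w. h w \<partial>lborel)" unfolding mult_2 by (rule add_mono[OF a b])
    also have "\<dots> = (\<integral>\<^sup>+w. 2 * h w \<partial>lborel)"
    proof (rule nn_integral_cmult[symmetric])
      have "h = (\<lambda>w. ennreal (c1 / bdist \<Omega> w) * (ennreal (norm (deriv g w)) * indicator \<Omega> w) * indicator W w)"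
        using pos by (auto simp: h_def fun_eq_iff indicator_def W_def bdist_def infdist_nonneg simp flip: ennreal_mult)
      also have "\<dots> \<in> borel_measurable borel"
        using borel_measurable_ennreal_indicator[OF continuous_on_norm[OF holomorphic_on_imp_continuous_on[OF holo']]]
        by measurable
      finally show "h \<in> borel_measurable lborel" by simp
    qed
    also have "\<dots> = (\<integral>\<^sup>+w\<in>W. ennreal (2 * c1 * norm (deriv g w) / bdist \<Omega> w) \<partial>lborel)"
    proof (intro nn_integral_cong)
      fix w
      have "ennreal (2 * (c1 * norm (deriv g w) / bdist \<Omega> w)) = 2 * ennreal (c1 * norm (deriv g w) / bdist \<Omega> w)"
        using pos by (subst ennreal_mult) (auto simp: bdist_def infdist_nonneg)
      then show "2 * h w = ennreal (2 * c1 * norm (deriv g w) / bdist \<Omega> w) * indicator W w"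
        by (simp add: h_def mult.assoc)
    qed
    finally show "ennreal (norm (g x - g z0)) \<le>
        (\<integral>\<^sup>+w\<in>{w\<in>\<Omega>. dist x w \<le> K * bdist \<Omega> w}. ennreal (2 * c1 * norm (deriv g w) / bdist \<Omega> w) \<partial>lborel)"
      by (simp add: W_def)
  qed
qed

subsection \<open>Integrals of powers of the distance to the boundary\<close>

text \<open>On layer j the integrand is at most 2^|e| D^e 2^(-j e), so the layers sum to a geometric
  series of ratio 2^(-(e+t)). The function d is kept abstract and t may be negative, because the
  lemma serves both for a distance and for the reciprocal of a distance.\<close>

lemma nn_integral_powr_layers:
  fixes d :: "'a \<Rightarrow> real" and e t A D :: real
  assumes [measurable]: "F \<in> sets M" "d \<in> borel_measurable M"
    and "0 < e + t" "0 < D" "0 \<le> A"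
    and d: "\<And>x. x \<in> F \<Longrightarrow> 0 < d x \<and> d x \<le> D"
    and layer: "\<And>j::nat. emeasure M {x\<in>F. D * 2 powr (-(real j + 1)) < d x \<and> d x \<le> D * 2 powr (- real j)}
        \<le> ennreal (A * 2 powr (- real j * t))"
  shows "(\<integral>\<^sup>+x\<in>F. ennreal (d x powr e) \<partial>M) \<le> ennreal (2 powr \<bar>e\<bar> / (1 - 2 powr (-(e + t))) * A * D powr e)"
proof -
  have FM: "F \<subseteq> space M" using sets.sets_into_space[OF assms(1)] .
  define L where "L = (\<lambda>j::nat. {x\<in>F. D * 2 powr (-(real j + 1)) < d x \<and> d x \<le> D * 2 powr (- real j)})"
  have L_eq: "L j = F \<inter> {x\<in>space M. D * 2 powr (-(real j + 1)) < d x \<and> d x \<le> D * 2 powr (- real j)}" for j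
    using FM by (auto simp: L_def)
  have [measurable]: "L j \<in> sets M" for j unfolding L_eq by measurable
  define c where "c = (\<lambda>j::nat. 2 powr \<bar>e\<bar> * D powr e * 2 powr (- real j * e))"
  have pw: "ennreal (d x powr e) * indicator F x \<le> (\<Sum>j. ennreal (c j) * indicator (L j) x)" for x
  proof (cases "x \<in> F")
    case True
    define k where "k = log 2 (D / d x)"
    have dx: "0 < d x" "d x \<le> D" using d True by auto
    then have "0 \<le> k" by (simp add: k_def)
    \<comment> \<open>The integer part of log2 (D / d x) is the index of the layer containing
      x.\<close>
    define j where "j = nat \<lfloor>k\<rfloor>"
    have j: "real j \<le> k" "k < real j + 1" using \<open>0 \<le> k\<close> by (auto simp: j_def)
    have dk: "d x = D * 2 powr (- k)"
      using dx \<open>0 < D\<close> by (simp add: k_def powr_minus_divide)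
    have xL: "x \<in> L j" using True j \<open>0 < D\<close> by (simp add: L_def dk)
    have "d x powr e = D powr e * 2 powr (- k * e)"
      using \<open>0 < D\<close> by (simp add: dk powr_mult powr_powr)
    \<comment> \<open>Since j and k differ by less than 1, the exponents differ by at most |e|,
      whichever sign e has.\<close>
    also have "2 powr (- k * e) \<le> 2 powr (\<bar>e\<bar> + - real j * e)"
    proof -
      have "(real j - k) * e \<le> \<bar>(real j - k) * e\<bar>" by simp
      also have "\<dots> \<le> 1 * \<bar>e\<bar>" unfolding abs_mult using j by (intro mult_right_mono) auto
      finally show ?thesis by (simp add: algebra_simps)
    qed
    also have "D powr e * 2 powr (\<bar>e\<bar> + - real j * e) = c j" unfolding c_def powr_add by simp
    finally have "d x powr e \<le> c j" by (simp add: mult_left_mono)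
    then have "ennreal (d x powr e) \<le> ennreal (c j) * indicator (L j) x"
      using xL by (simp add: ennreal_leI)
    also have "\<dots> = (\<Sum>i\<in>{j}. ennreal (c i) * indicator (L i) x)" by (subst sum.insert) auto
    also have "\<dots> \<le> (\<Sum>i. ennreal (c i) * indicator (L i) x)" by (rule sum_le_suminf) auto
    finally show ?thesis using True by simp
  qed simp
  define g where "g = 2 powr (-(e + t))"
  have g: "0 < g" "g < 1" using \<open>0 < e + t\<close> powr_less_mono[of "-(e+t)" 0 2] by (auto simp: g_def)
  have "(\<integral>\<^sup>+x\<in>F. ennreal (d x powr e) \<partial>M) \<le> (\<integral>\<^sup>+x. (\<Sum>j. ennreal (c j) * indicator (L j) x) \<partial>M)"
    by (intro nn_integral_mono pw)
  also have "\<dots> = (\<Sum>j. \<integral>\<^sup>+x. ennreal (c j) * indicator (L j) x \<partial>M)"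
    by (rule nn_integral_suminf) auto
  also have "\<dots> = (\<Sum>j. ennreal (c j) * emeasure M (L j))"
    by (simp add: nn_integral_cmult)
  also have "\<dots> \<le> (\<Sum>j. ennreal (2 powr \<bar>e\<bar> * D powr e * A * g ^ j))"
  proof (intro suminf_le summableI)
    fix j
    have "ennreal (c j) * emeasure M (L j) \<le> ennreal (c j) * ennreal (A * 2 powr (- real j * t))"
      using layer[of j] by (intro mult_left_mono) (auto simp: L_def)
    also have "\<dots> = ennreal (c j * (A * 2 powr (- real j * t)))"
      using \<open>0 \<le> A\<close> by (subst ennreal_mult) (auto simp: c_def)
    also have "c j * (A * 2 powr (- real j * t)) = 2 powr \<bar>e\<bar> * D powr e * A * g ^ j"
    proof -
      have "g ^ j = 2 powr (- real j * e) * 2 powr (- real j * t)"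
        by (simp add: g_def powr_add[symmetric] powr_power algebra_simps)
      then show ?thesis by (simp add: c_def)
    qed
    finally show "ennreal (c j) * emeasure M (L j) \<le> ennreal (2 powr \<bar>e\<bar> * D powr e * A * g ^ j)" .
  qed
  also have "\<dots> = ennreal (\<Sum>j. 2 powr \<bar>e\<bar> * D powr e * A * g ^ j)"
    using g \<open>0 \<le> A\<close> by (intro suminf_ennreal2 summable_mult summable_geometric) auto
  also have "(\<Sum>j. 2 powr \<bar>e\<bar> * D powr e * A * g ^ j) = 2 powr \<bar>e\<bar> * D powr e * A * (1 / (1 - g))"
    using g by (subst suminf_mult) (auto intro: summable_geometric simp: suminf_geometric)
  also have "\<dots> = 2 powr \<bar>e\<bar> / (1 - 2 powr (-(e + t))) * A * D powr e" by (simp add: g_def)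
  finally show ?thesis .
qed

text \<open>An infimum of a nonempty set of extended naturals is attained, so the bound on the
  covering number is realised by an actual finite cover, with an exponent strictly below a.\<close>

lemma assouad_dim_less_cover:
  assumes "assouad_dim E < ereal a"
  obtains s C where "0 \<le> s" "s < a" "0 < C"
    "\<And>x r R. x \<in> E \<Longrightarrow> 0 < r \<Longrightarrow> r < R \<Longrightarrow>
        \<exists>F. finite F \<and> real (card F) \<le> C * (R / r) powr s \<and> E \<inter> ball x R \<subseteq> (\<Union>c\<in>F. ball c r)"
proof -
  from assms obtain s C where s: "0 \<le> s" "s < a" "0 < C"
    and cov: "\<And>x r R. x \<in> E \<Longrightarrow> 0 < r \<Longrightarrow> r < R \<Longrightarrow>
       ereal_of_enat (covering_number r (E \<inter> ball x R)) \<le> ereal (C * (R / r) powr s)"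
    unfolding assouad_dim_def Inf_less_iff by auto
  have "\<exists>F. finite F \<and> real (card F) \<le> C * (R / r) powr s \<and> E \<inter> ball x R \<subseteq> (\<Union>c\<in>F. ball c r)"
    if x: "x \<in> E" "0 < r" "r < R" for x r R
  proof -
    let ?S = "{F. finite F \<and> E \<inter> ball x R \<subseteq> (\<Union>c\<in>F. ball c r)}"
    have le: "ereal_of_enat (Inf ((\<lambda>F. enat (card F)) ` ?S)) \<le> ereal (C * (R / r) powr s)"
      using cov[OF x] by (simp add: covering_number_def)
    \<comment> \<open>Without any finite cover the infimum would be \<infinity>, contradicting the
      finite bound.\<close>
    have "(\<lambda>F. enat (card F)) ` ?S \<noteq> {}"
    proof
      assume *: "(\<lambda>F. enat (card F)) ` ?S = {}"
      show False using le unfolding * by (simp add: top_enat_def)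
    qed
    then have "Inf ((\<lambda>F. enat (card F)) ` ?S) \<in> (\<lambda>F. enat (card F)) ` ?S"
      by (metis (no_types, lifting) Inf_enat_def LeastI all_not_in_conv)
    then obtain F where "F \<in> ?S" "Inf ((\<lambda>F. enat (card F)) ` ?S) = enat (card F)" by blast
    with le show ?thesis by auto
  qed
  with s that show ?thesis by blast
qed

text \<open>The layer at distance about r = R 2^(-j) from E is covered by doubling the balls of a
  cover of E at scale r. Its area is therefore at most C (3R/r)^s 4 pi r^2, a multiple of R^2
  2^(-j(2-s)), and the series converges because (b - 2) + (2 - s) = b - s > 0.\<close>

lemma nn_integral_infdist_powr_ball:
  fixes E :: "complex set"
  assumes "closed E" "0 \<le> s" "s < b" "0 < C"
    and cov: "\<And>x r R. x \<in> E \<Longrightarrow> 0 < r \<Longrightarrow> r < R \<Longrightarrow>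
        \<exists>F. finite F \<and> real (card F) \<le> C * (R / r) powr s \<and> E \<inter> ball x R \<subseteq> (\<Union>c\<in>F. ball c r)"
  obtains K where "0 < K"
    "\<And>x R. x \<in> E \<Longrightarrow> 0 < R \<Longrightarrow>
      (\<integral>\<^sup>+y\<in>ball x R - E. ennreal (infdist y E powr (b - 2)) \<partial>lborel) \<le> ennreal (K * R powr b)"
proof
  define K where "K = 2 powr \<bar>b - 2\<bar> / (1 - 2 powr (-(b - s))) * (C * 3 powr s * 4 * pi)"
  have "2 powr (-(b - s)) < (1::real)"
    using \<open>s < b\<close> powr_less_mono[of "-(b-s)" 0 2] by auto
  then show "0 < K" using \<open>0 < C\<close> by (simp add: K_def)
  fix x R assume x: "x \<in> E" and R: "0 < (R::real)"
  then have "E \<noteq> {}" by auto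
  have [measurable]: "E \<in> sets borel" using \<open>closed E\<close> by auto
  have [measurable]: "(\<lambda>y. infdist y E) \<in> borel_measurable borel"
    by (intro borel_measurable_continuous_onI continuous_intros)
  have "(\<integral>\<^sup>+y\<in>ball x R - E. ennreal (infdist y E powr (b - 2)) \<partial>lborel)
     \<le> ennreal (2 powr \<bar>b - 2\<bar> / (1 - 2 powr (-((b - 2) + (2 - s)))) * (C * 3 powr s * 4 * pi * R\<^sup>2) * R powr (b - 2))"
  proof (rule nn_integral_powr_layers)
    show "0 < infdist y E \<and> infdist y E \<le> R" if "y \<in> ball x R - E" for y
      using that infdist_pos_not_in_closed[OF \<open>closed E\<close> \<open>E \<noteq> {}\<close>] infdist_le[OF x, of y]
      by (auto simp: dist_commute)
    fix j :: nat
    define r where "r = R * 2 powr (- real j)"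
    have "2 powr (- real j) \<le> (1::real)" using powr_mono[of "- real j" 0 2] by simp
    then have r: "0 < r" "r \<le> R" using R by (auto simp: r_def)
    \<comment> \<open>The radius 3 R is large enough to contain the points of E nearest to points of
      the layer, and it keeps r below it also for j = 0.\<close>
    obtain F where F: "finite F" "real (card F) \<le> C * (3 * R / r) powr s" "E \<inter> ball x (3 * R) \<subseteq> (\<Union>c\<in>F. ball c r)"
      using cov[OF x r(1), of "3 * R"] r R by auto
    have "{y \<in> ball x R - E. R * 2 powr (- (real j + 1)) < infdist y E \<and> infdist y E \<le> R * 2 powr - real j}
       \<subseteq> (\<Union>c\<in>F. ball c (2 * r))"
    proof clarify
      fix y assume y: "y \<in> ball x R" "infdist y E \<le> R * 2 powr - real j"
      obtain w where w: "w \<in> E" "infdist y E = dist y w"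
        using infdist_attains_inf[OF \<open>closed E\<close> \<open>E \<noteq> {}\<close>] by metis
      have "dist y w \<le> r" using w y by (simp add: r_def)
      have "dist x w \<le> dist x y + dist y w" by (rule dist_triangle)
      then have "w \<in> E \<inter> ball x (3 * R)" using w y \<open>dist y w \<le> r\<close> r R by simp
      then obtain c where "c \<in> F" "dist c w < r" using F(3) by auto
      moreover have "dist c y < 2 * r"
        using dist_triangle[of c y w] \<open>dist y w \<le> r\<close> \<open>dist c w < r\<close> by (simp add: dist_commute)
      ultimately show "y \<in> (\<Union>c\<in>F. ball c (2 * r))" by auto
    qed
    then have "emeasure lborel {y \<in> ball x R - E. R * 2 powr (- (real j + 1)) < infdist y E \<and> infdist y E \<le> R * 2 powr - real j}
       \<le> emeasure lborel (\<Union>c\<in>F. ball c (2 * r))"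
      by (rule emeasure_mono) (auto intro!: borel_open)
    also have "\<dots> \<le> (\<Sum>c\<in>F. emeasure lborel (ball c (2 * r)))"
      by (rule emeasure_subadditive_finite) (use F in auto)
    also have "\<dots> = ennreal (real (card F) * (pi * (2 * r)\<^sup>2))"
      using r by (simp add: emeasure_disc ennreal_mult ennreal_of_nat_eq_real_of_nat)
    also have "\<dots> \<le> ennreal (C * (3 * R / r) powr s * (pi * (2 * r)\<^sup>2))"
      using F(2) by (intro ennreal_leI mult_right_mono) auto
    also have "C * (3 * R / r) powr s * (pi * (2 * r)\<^sup>2) = C * 3 powr s * 4 * pi * R\<^sup>2 * 2 powr (- real j * (2 - s))"
    proof -
      have 1: "(3 * R / r) powr s = 3 powr s * 2 powr (real j * s)"
        using R by (simp add: r_def powr_minus_divide powr_mult powr_powr)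
      have 2: "(2 powr (- real j))\<^sup>2 = 2 powr (- real j * 2)"
        by (simp add: powr_power mult.commute)
      have 3: "2 powr (- real j * (2 - s)) = 2 powr (real j * s) * 2 powr (- real j * 2)"
        by (simp add: powr_add[symmetric] algebra_simps)
      have 4: "(2 * r)\<^sup>2 = 4 * R\<^sup>2 * 2 powr (- real j * 2)" unfolding r_def power_mult_distrib 2 by simp
      show ?thesis unfolding 1 3 4 by simp
    qed
    finally show "emeasure lborel {y \<in> ball x R - E. R * 2 powr (- (real j + 1)) < infdist y E \<and> infdist y E \<le> R * 2 powr - real j}
       \<le> ennreal (C * 3 powr s * 4 * pi * R\<^sup>2 * 2 powr (- real j * (2 - s)))" .
  qed (use R \<open>s < b\<close> \<open>0 < C\<close> in auto)
  also have "2 powr \<bar>b - 2\<bar> / (1 - 2 powr (-((b - 2) + (2 - s)))) * (C * 3 powr s * 4 * pi * R\<^sup>2) * R powr (b - 2) = K * R powr b"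
    using R by (simp add: K_def powr_diff)
  finally show "(\<integral>\<^sup>+y\<in>ball x R - E. ennreal (infdist y E powr (b - 2)) \<partial>lborel) \<le> ennreal (K * R powr b)" .
qed

text \<open>The layers are taken for 1/\<delta>. In layer j the membership condition forces |x - w|
  to be at most K 2^(j+1) / D, so the area grows no faster than 4^j; the integrand decays like
  2^(-j(2+s)), which leaves the ratio 2^(-s).\<close>

lemma nn_integral_shadow_powr:
  assumes \<Omega>: "open \<Omega>" "frontier \<Omega> \<noteq> {}" and "0 < K" "0 < s"
  obtains c where "0 < c" "\<And>x. x \<in> \<Omega> \<Longrightarrow>
    (\<integral>\<^sup>+w\<in>{w\<in>\<Omega>. dist x w \<le> K * bdist \<Omega> w}. ennreal (bdist \<Omega> w powr (- 2 - s)) \<partial>lborel)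
      \<le> ennreal (c * bdist \<Omega> x powr (- s))"
proof
  define c where "c = 2 powr \<bar>2 + s\<bar> / (1 - 2 powr (-((2 + s) + -2))) * (pi * K\<^sup>2 * 4) * (1 + K) powr s"
  have "2 powr (- s) < (1::real)"
    using \<open>0 < s\<close> powr_less_mono[of "-s" 0 2] by auto
  then show "0 < c" using \<open>0 < K\<close> by (simp add: c_def)
  have [measurable]: "\<Omega> \<in> sets borel" using \<Omega> by auto
  fix x assume x: "x \<in> \<Omega>"
  have \<delta>x: "0 < bdist \<Omega> x" by (rule bdist_pos[OF \<Omega> x])
  \<comment> \<open>The largest possible value of 1/\<delta>(w): \<delta>(x) \<le> \<delta>(w) + |x
    - w| \<le> (1 + K) \<delta>(w).\<close>
  define D where "D = (1 + K) / bdist \<Omega> x"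
  have "0 < D" using \<delta>x \<open>0 < K\<close> by (simp add: D_def)
  define F where "F = {w\<in>\<Omega>. dist x w \<le> K * bdist \<Omega> w}"
  have [measurable]: "F \<in> sets borel" unfolding F_def by measurable
  have pos: "0 < bdist \<Omega> w" if "w \<in> F" for w using bdist_pos[OF \<Omega>] that by (auto simp: F_def)
  have "(\<integral>\<^sup>+w\<in>F. ennreal (bdist \<Omega> w powr (- 2 - s)) \<partial>lborel) = (\<integral>\<^sup>+w\<in>F. ennreal ((1 / bdist \<Omega> w) powr (2 + s)) \<partial>lborel)"
  proof (intro nn_integral_cong)
    fix w
    have "bdist \<Omega> w powr (- 2 - s) = (1 / bdist \<Omega> w) powr (2 + s)" if "w \<in> F"
    proof -
      have "- 2 - s = - (2 + s)" by simp
      then show ?thesis using pos[OF that] by (metis powr_minus powr_divide powr_one_eq_one inverse_eq_divide less_imp_le zero_le_one)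
    qed
    then show "ennreal (bdist \<Omega> w powr (- 2 - s)) * indicator F w = ennreal ((1 / bdist \<Omega> w) powr (2 + s)) * indicator F w"
      by (auto simp: indicator_def)
  qed
  also have "\<dots> \<le> ennreal (2 powr \<bar>2 + s\<bar> / (1 - 2 powr (-((2 + s) + -2))) * (pi * K\<^sup>2 * 4 / D\<^sup>2) * D powr (2 + s))"
  proof (rule nn_integral_powr_layers)
    show "0 < 1 / bdist \<Omega> w \<and> 1 / bdist \<Omega> w \<le> D" if w: "w \<in> F" for w
    proof -
      have "bdist \<Omega> x \<le> bdist \<Omega> w + dist x w" by (rule bdist_triangle)
      also have "\<dots> \<le> (1 + K) * bdist \<Omega> w" using w by (simp add: F_def algebra_simps)
      finally show ?thesis using pos[OF w] \<delta>x by (simp add: D_def field_simps)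
    qed
    fix j :: nat
    define \<rho> where "\<rho> = K * 2 powr (real j + 1) / D"
    have "0 \<le> \<rho>" using \<open>0 < K\<close> \<open>0 < D\<close> by (simp add: \<rho>_def)
    have "{w\<in>F. D * 2 powr (-(real j + 1)) < 1 / bdist \<Omega> w \<and> 1 / bdist \<Omega> w \<le> D * 2 powr (- real j)} \<subseteq> cball x \<rho>"
    proof clarify
      fix w assume w: "w \<in> F" "D * 2 powr (-(real j + 1)) < 1 / bdist \<Omega> w"
      then have "D / 2 powr (real j + 1) < 1 / bdist \<Omega> w" by (simp only: powr_minus_divide times_divide_eq_right mult_1_right)
      then have "bdist \<Omega> w \<le> 2 powr (real j + 1) / D"
        using pos[OF w(1)] \<open>0 < D\<close> by (simp add: field_simps)
      then have "K * bdist \<Omega> w \<le> \<rho>" unfolding \<rho>_def times_divide_eq_right[symmetric] using \<open>0 < K\<close> by (intro mult_left_mono) auto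
      then show "w \<in> cball x \<rho>" using w by (auto simp: F_def)
    qed
    then have "emeasure lborel {w\<in>F. D * 2 powr (-(real j + 1)) < 1 / bdist \<Omega> w \<and> 1 / bdist \<Omega> w \<le> D * 2 powr (- real j)}
       \<le> emeasure lborel (cball x \<rho>)"
      by (rule emeasure_mono) simp
    also have "\<dots> = ennreal (pi * \<rho>\<^sup>2)" by (rule emeasure_cdisc) fact
    also have "pi * \<rho>\<^sup>2 = pi * K\<^sup>2 * 4 / D\<^sup>2 * 2 powr (- real j * -2)"
    proof -
      have "(2 powr (real j + 1))\<^sup>2 = 4 * 2 powr (- real j * -2)"
        by (simp add: powr_add power_mult_distrib powr_power mult.commute)
      then show ?thesis unfolding \<rho>_def power_divide power_mult_distrib by simp
    qed
    finally show "emeasure lborel {w\<in>F. D * 2 powr (-(real j + 1)) < 1 / bdist \<Omega> w \<and> 1 / bdist \<Omega> w \<le> D * 2 powr (- real j)}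
       \<le> ennreal (pi * K\<^sup>2 * 4 / D\<^sup>2 * 2 powr (- real j * -2))" .
  qed (use \<open>0 < s\<close> \<open>0 < D\<close> in auto)
  also have "2 powr \<bar>2 + s\<bar> / (1 - 2 powr (-((2 + s) + -2))) * (pi * K\<^sup>2 * 4 / D\<^sup>2) * D powr (2 + s) = c * bdist \<Omega> x powr (- s)"
  proof -
    have "D powr (2 + s) = D\<^sup>2 * ((1 + K) powr s * bdist \<Omega> x powr (- s))"
      using \<open>0 < D\<close> \<delta>x \<open>0 < K\<close> by (simp add: powr_add) (simp add: D_def powr_divide powr_minus_divide)
    then show ?thesis unfolding c_def using \<open>0 < D\<close> by simp
  qed
  finally show "(\<integral>\<^sup>+w\<in>{w\<in>\<Omega>. dist x w \<le> K * bdist \<Omega> w}. ennreal (bdist \<Omega> w powr (- 2 - s)) \<partial>lborel)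
      \<le> ennreal (c * bdist \<Omega> x powr (- s))" by (simp add: F_def)
qed

text \<open>The disc is moved to the boundary point nearest to w. The radius (K + 1) \<delta>(w)
  would only give a closed ball; K + 2 makes the inclusion into an open one immediate.\<close>

lemma nn_integral_bdist_powr_disc:
  assumes \<Omega>: "open \<Omega>" "frontier \<Omega> \<noteq> {}" and "0 < K" "0 < c"
    and ball: "\<And>x R. x \<in> frontier \<Omega> \<Longrightarrow> 0 < R \<Longrightarrow>
      (\<integral>\<^sup>+y\<in>ball x R - frontier \<Omega>. ennreal (infdist y (frontier \<Omega>) powr (b - 2)) \<partial>lborel) \<le> ennreal (c * R powr b)"
    and w: "w \<in> \<Omega>"
  shows "(\<integral>\<^sup>+x\<in>{x\<in>\<Omega>. dist x w \<le> K * bdist \<Omega> w}. ennreal (bdist \<Omega> x powr (b - 2)) \<partial>lborel)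
      \<le> ennreal (c * (K + 2) powr b * bdist \<Omega> w powr b)"
proof -
  have \<delta>w: "0 < bdist \<Omega> w" by (rule bdist_pos[OF \<Omega> w])
  obtain \<xi> where \<xi>: "\<xi> \<in> frontier \<Omega>" "bdist \<Omega> w = dist w \<xi>"
    unfolding bdist_def using infdist_attains_inf[OF frontier_closed \<Omega>(2)] by metis
  have "{x\<in>\<Omega>. dist x w \<le> K * bdist \<Omega> w} \<subseteq> ball \<xi> ((K + 2) * bdist \<Omega> w) - frontier \<Omega>"
  proof clarify
    fix x assume x: "x \<in> \<Omega>" "dist x w \<le> K * bdist \<Omega> w"
    have "dist \<xi> x \<le> dist x w + dist w \<xi>" using dist_triangle[of x \<xi> w] by (simp add: dist_commute)
    then have "dist \<xi> x < (K + 2) * bdist \<Omega> w" using x(2) \<delta>w unfolding \<xi>(2) distrib_right by linarith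
    moreover have "x \<notin> frontier \<Omega>" using x \<Omega> by (simp add: frontier_def interior_open)
    ultimately show "x \<in> ball \<xi> ((K + 2) * bdist \<Omega> w) - frontier \<Omega>" by simp
  qed
  then have "(\<integral>\<^sup>+x\<in>{x\<in>\<Omega>. dist x w \<le> K * bdist \<Omega> w}. ennreal (bdist \<Omega> x powr (b - 2)) \<partial>lborel)
     \<le> (\<integral>\<^sup>+y\<in>ball \<xi> ((K + 2) * bdist \<Omega> w) - frontier \<Omega>. ennreal (infdist y (frontier \<Omega>) powr (b - 2)) \<partial>lborel)"
    by (intro nn_integral_mono) (auto simp: bdist_def indicator_def)
  also have "\<dots> \<le> ennreal (c * ((K + 2) * bdist \<Omega> w) powr b)"
    by (rule ball) (use \<xi> \<delta>w \<open>0 < K\<close> in auto)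
  also have "c * ((K + 2) * bdist \<Omega> w) powr b = c * (K + 2) powr b * bdist \<Omega> w powr b"
    using \<delta>w \<open>0 < K\<close> by (simp add: powr_mult)
  finally show ?thesis .
qed

text \<open>A single boundary ball contains the bounded set \<Omega>. This gives constant functions
  a finite weighted norm.\<close>

lemma nn_integral_bdist_powr_finite:
  assumes \<Omega>: "open \<Omega>" "bounded \<Omega>" "frontier \<Omega> \<noteq> {}"
    and ball: "\<And>x R. x \<in> frontier \<Omega> \<Longrightarrow> 0 < R \<Longrightarrow>
      (\<integral>\<^sup>+y\<in>ball x R - frontier \<Omega>. ennreal (infdist y (frontier \<Omega>) powr e) \<partial>lborel) \<le> ennreal (c * R powr b)"
  shows "(\<integral>\<^sup>+x\<in>\<Omega>. ennreal (bdist \<Omega> x powr e) \<partial>lborel) < \<infinity>"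
proof -
  obtain \<xi> where \<xi>: "\<xi> \<in> frontier \<Omega>" using \<Omega>(3) by auto
  obtain R where R: "0 < R" "\<Omega> \<subseteq> ball \<xi> R" using bounded_subset_ballD[OF \<Omega>(2)] by blast
  have "\<Omega> \<inter> frontier \<Omega> = {}" using \<Omega>(1) by (auto simp: frontier_def interior_open)
  then have "(\<integral>\<^sup>+x\<in>\<Omega>. ennreal (bdist \<Omega> x powr e) \<partial>lborel)
     \<le> (\<integral>\<^sup>+y\<in>ball \<xi> R - frontier \<Omega>. ennreal (infdist y (frontier \<Omega>) powr e) \<partial>lborel)"
    using R by (intro nn_integral_mono) (auto simp: bdist_def indicator_def)
  also have "\<dots> \<le> ennreal (c * R powr b)" by (rule ball[OF \<xi> R(1)])
  finally show ?thesis by (simp add: le_less_trans)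
qed

subsection \<open>Weighted inequalities\<close>

lemma powr_le_of_ratio:
  fixes x y e :: real
  assumes "0 < x" "0 < y" "x \<le> 2 * y" "y \<le> 2 * x"
  shows "x powr e \<le> 2 powr \<bar>e\<bar> * y powr e"
proof (cases "0 \<le> e")
  case True
  then have "x powr e \<le> (2 * y) powr e" using assms by (intro powr_mono2) auto
  then show ?thesis using True assms by (simp add: powr_mult)
next
  case False
  then have "x powr e \<le> (y / 2) powr e" using assms by (intro powr_mono2') auto
  then show ?thesis using False assms by (simp add: powr_divide powr_minus_divide)
qed

lemma powr_add_le_2_powr:
  fixes x y p :: real
  assumes "0 \<le> x" "0 \<le> y" "0 \<le> p"
  shows "(x + y) powr p \<le> 2 powr p * (x powr p + y powr p)"
proof -
  have "(x + y) powr p \<le> (2 * max x y) powr p" using assms by (intro powr_mono2) auto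
  also have "\<dots> = 2 powr p * (max x y) powr p" using assms by (simp add: powr_mult)
  also have "(max x y) powr p \<le> x powr p + y powr p" by (auto simp: max_def)
  finally show ?thesis by simp
qed

text \<open>The local bound contributes \<delta>^(-p-2), so \<delta>^(a+p-2) becomes \<delta>^(a-4);
  the area of the disc of admissible z for fixed w restores two powers. Only comparability of
  \<delta> on small discs enters, hence a is arbitrary.\<close>

lemma weighted_deriv_le:
  assumes \<Omega>: "open \<Omega>" "frontier \<Omega> \<noteq> {}" and "1 < p"
  obtains C where "0 < C"
    "\<And>g. g holomorphic_on \<Omega> \<Longrightarrow>
      (\<integral>\<^sup>+z\<in>\<Omega>. ennreal (norm (deriv g z) powr p * bdist \<Omega> z powr (a + p - 2)) \<partial>lborel)
      \<le> ennreal C * (\<integral>\<^sup>+z\<in>\<Omega>. ennreal (norm (g z) powr p * bdist \<Omega> z powr (a - 2)) \<partial>lborel)"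
proof
  define c1 where "c1 = 2 powr p * 4 / pi * 2 powr (p + 2)"
  define c2 where "c2 = c1 * 2 powr \<bar>a - 4\<bar>"
  have "0 < c1" by (simp add: c1_def)
  then have "0 < c2" by (simp add: c2_def)
  then show "0 < c2 * pi" by simp
  fix g assume holo: "g holomorphic_on \<Omega>"
  have [measurable]: "\<Omega> \<in> sets borel" using \<Omega> by auto
  define N where "N = (\<lambda>w. ennreal (norm (g w) powr p) * indicator \<Omega> w)"
  have [measurable]: "N \<in> borel_measurable borel" unfolding N_def
  proof (intro borel_measurable_ennreal_indicator continuous_on_powr')
    show "continuous_on \<Omega> (\<lambda>w. norm (g w))"
      by (intro continuous_on_norm holomorphic_on_imp_continuous_on holo)
  qed (use \<open>1 < p\<close> in auto)
  \<comment> \<open>The condition |z - w| < \<delta>(z)/2 implies |z - w| < \<delta>(w). Recentring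
    at w makes the inner integral over z the area of a disc.\<close>
  define k where "k = (\<lambda>z w. ennreal (c2 * bdist \<Omega> w powr (a - 4)) * (if dist z w < bdist \<Omega> w then N w else 0))"
  have [measurable]: "(\<lambda>(z, w). k z w) \<in> borel_measurable (lborel \<Otimes>\<^sub>M lborel)"
    unfolding k_def by measurable
  have pw: "ennreal (norm (deriv g z) powr p * bdist \<Omega> z powr (a + p - 2)) * indicator \<Omega> z \<le> (\<integral>\<^sup>+w. k z w \<partial>lborel)" for z
  proof (cases "z \<in> \<Omega>")
    case True
    define d where "d = bdist \<Omega> z"
    have "0 < d" unfolding d_def by (rule bdist_pos[OF \<Omega> True])
    have sub: "ball z (d / 2) \<subseteq> \<Omega>" by (rule ball_bdist_subset) (use \<open>0 < d\<close> True in \<open>auto simp: d_def\<close>)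
    have "ennreal (norm (deriv g z) powr p) \<le>
        ennreal (2 powr p * 4 / pi * (d / 2) powr (- p - 2)) * (\<integral>\<^sup>+w\<in>ball z (d / 2). ennreal (norm (g w) powr p) \<partial>lborel)"
      by (rule submean_value_deriv_powr) (use \<open>0 < d\<close> \<open>1 < p\<close> holomorphic_on_subset[OF holo sub] in auto)
    also have "2 powr p * 4 / pi * (d / 2) powr (- p - 2) = c1 * d powr (- p - 2)"
      using \<open>0 < d\<close> by (simp add: c1_def powr_divide powr_minus powr_diff powr_add field_simps)
    finally have "ennreal (d powr (a + p - 2)) * ennreal (norm (deriv g z) powr p)
       \<le> ennreal (d powr (a + p - 2)) * (ennreal (c1 * d powr (- p - 2)) * (\<integral>\<^sup>+w\<in>ball z (d / 2). ennreal (norm (g w) powr p) \<partial>lborel))"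
      by (rule mult_left_mono) simp
    also have "\<dots> = ennreal (c1 * d powr (a - 4)) * (\<integral>\<^sup>+w\<in>ball z (d / 2). ennreal (norm (g w) powr p) \<partial>lborel)"
      using \<open>0 < d\<close> \<open>0 < c1\<close> unfolding mult.assoc[symmetric]
      by (simp flip: ennreal_mult) (simp add: powr_add[symmetric] mult_ac)
    also have "(\<integral>\<^sup>+w\<in>ball z (d / 2). ennreal (norm (g w) powr p) \<partial>lborel) = (\<integral>\<^sup>+w. (if dist z w < d / 2 then N w else 0) \<partial>lborel)"
      using sub by (intro nn_integral_cong) (auto simp: N_def indicator_def)
    also have "ennreal (c1 * d powr (a - 4)) * \<dots> = (\<integral>\<^sup>+w. ennreal (c1 * d powr (a - 4)) * (if dist z w < d / 2 then N w else 0) \<partial>lborel)"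
      by (rule nn_integral_cmult[symmetric]) simp
    also have "\<dots> \<le> (\<integral>\<^sup>+w. k z w \<partial>lborel)"
    proof (intro nn_integral_mono)
      fix w
      show "ennreal (c1 * d powr (a - 4)) * (if dist z w < d / 2 then N w else 0) \<le> k z w"
      proof (cases "dist z w < d / 2 \<and> w \<in> \<Omega>")
        case True
        define b where "b = bdist \<Omega> w"
        have "0 < b" unfolding b_def using bdist_pos[OF \<Omega>] True by simp
        have "d \<le> b + dist z w" unfolding d_def b_def by (rule bdist_triangle)
        moreover have "b \<le> d + dist w z" unfolding d_def b_def by (rule bdist_triangle)
        ultimately have b: "dist z w < b" "d \<le> 2 * b" "b \<le> 2 * d"
          using True \<open>0 < d\<close> dist_commute[of z w] by linarith+
        have "d powr (a - 4) \<le> 2 powr \<bar>a - 4\<bar> * b powr (a - 4)"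
          by (rule powr_le_of_ratio) (use b \<open>0 < b\<close> \<open>0 < d\<close> in auto)
        then have "c1 * d powr (a - 4) \<le> c2 * b powr (a - 4)"
          using \<open>0 < c1\<close> unfolding c2_def mult.assoc by (intro mult_left_mono) auto
        then have "ennreal (c1 * d powr (a - 4)) * N w \<le> ennreal (c2 * b powr (a - 4)) * N w"
          by (intro mult_right_mono ennreal_leI) auto
        then show ?thesis using True b by (simp add: k_def b_def)
      qed (auto simp: N_def)
    qed
    finally show ?thesis using True by (simp add: d_def mult.commute flip: ennreal_mult)
  qed auto
  have "(\<integral>\<^sup>+z\<in>\<Omega>. ennreal (norm (deriv g z) powr p * bdist \<Omega> z powr (a + p - 2)) \<partial>lborel)
     \<le> (\<integral>\<^sup>+z. \<integral>\<^sup>+w. k z w \<partial>lborel \<partial>lborel)" by (intro nn_integral_mono pw)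
  also have "\<dots> = (\<integral>\<^sup>+w. \<integral>\<^sup>+z. k z w \<partial>lborel \<partial>lborel)"
    by (rule lborel_pair.Fubini'[symmetric]) measurable
  also have "\<dots> = (\<integral>\<^sup>+w. ennreal (c2 * pi) * (ennreal (norm (g w) powr p * bdist \<Omega> w powr (a - 2)) * indicator \<Omega> w) \<partial>lborel)"
  proof (intro nn_integral_cong)
    fix w
    define b where "b = bdist \<Omega> w"
    have "0 \<le> b" by (simp add: b_def bdist_def infdist_nonneg)
    have "(\<integral>\<^sup>+z. k z w \<partial>lborel) = (\<integral>\<^sup>+z. ennreal (c2 * b powr (a - 4)) * N w * indicator (ball w b) z \<partial>lborel)"
      by (intro nn_integral_cong) (auto simp: k_def b_def indicator_def dist_commute)
    also have "\<dots> = ennreal (c2 * b powr (a - 4)) * N w * ennreal (pi * b\<^sup>2)"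
      using \<open>0 \<le> b\<close> by (subst nn_integral_cmult) (auto simp: emeasure_disc intro!: borel_measurable_indicator)
    also have "\<dots> = ennreal (c2 * pi) * (ennreal (norm (g w) powr p * b powr (a - 2)) * indicator \<Omega> w)"
    proof (cases "w \<in> \<Omega>")
      case True
      have "0 < b" unfolding b_def using bdist_pos[OF \<Omega>] True by simp
      have "b powr (a - 4) * b\<^sup>2 = b powr (a - 4) * b powr 2" using \<open>0 < b\<close> by simp
      also have "\<dots> = b powr (a - 2)" unfolding powr_add[symmetric] by simp
      finally have *: "b powr (a - 4) * b\<^sup>2 = b powr (a - 2)" .
      show ?thesis using True \<open>0 < c2\<close> unfolding *[symmetric]
        by (simp add: N_def mult_ac flip: ennreal_mult)
    qed (simp add: N_def)
    finally show "(\<integral>\<^sup>+z. k z w \<partial>lborel) = ennreal (c2 * pi) * (ennreal (norm (g w) powr p * bdist \<Omega> w powr (a - 2)) * indicator \<Omega> w)"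
      by (simp add: b_def)
  qed
  also have "\<dots> = ennreal (c2 * pi) * (\<integral>\<^sup>+z\<in>\<Omega>. ennreal (norm (g z) powr p * bdist \<Omega> z powr (a - 2)) \<partial>lborel)"
  proof (rule nn_integral_cmult)
    have "(\<lambda>w. ennreal (norm (g w) powr p * bdist \<Omega> w powr (a - 2)) * indicator \<Omega> w) = (\<lambda>w. N w * ennreal (bdist \<Omega> w powr (a - 2)))"
      by (auto simp: N_def fun_eq_iff indicator_def ennreal_mult)
    then show "(\<lambda>w. ennreal (norm (g w) powr p * bdist \<Omega> w powr (a - 2)) * indicator \<Omega> w) \<in> borel_measurable lborel"
      by simp
  qed
  finally show "(\<integral>\<^sup>+z\<in>\<Omega>. ennreal (norm (deriv g z) powr p * bdist \<Omega> z powr (a + p - 2)) \<partial>lborel)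
      \<le> ennreal (c2 * pi) * (\<integral>\<^sup>+z\<in>\<Omega>. ennreal (norm (g z) powr p * bdist \<Omega> z powr (a - 2)) \<partial>lborel)" .
qed

text \<open>On the disc of radius \<delta>(z0)/2 the values of \<delta> lie within a factor 2 of
  \<delta>(z0), so the weight can be inserted into the sub-mean value inequality at the cost of a
  constant depending on z0.\<close>

lemma weighted_point_le:
  assumes \<Omega>: "open \<Omega>" "frontier \<Omega> \<noteq> {}" and "1 < p" and z0: "z0 \<in> \<Omega>"
  obtains C where "0 < C"
    "\<And>g. g holomorphic_on \<Omega> \<Longrightarrow>
      ennreal (norm (g z0) powr p * bdist \<Omega> z0 powr a)
      \<le> ennreal C * (\<integral>\<^sup>+z\<in>\<Omega>. ennreal (norm (g z) powr p * bdist \<Omega> z powr (a - 2)) \<partial>lborel)"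
proof
  define d where "d = bdist \<Omega> z0"
  have "0 < d" unfolding d_def by (rule bdist_pos[OF \<Omega> z0])
  define c where "c = 4 / pi * d powr (a - 2) * (2 powr \<bar>2 - a\<bar> * d powr (2 - a))"
  show "0 < c" using \<open>0 < d\<close> by (simp add: c_def)
  fix g assume holo: "g holomorphic_on \<Omega>"
  have [measurable]: "\<Omega> \<in> sets borel" using \<Omega> by auto
  have sub: "ball z0 (d / 2) \<subseteq> \<Omega>" by (rule ball_bdist_subset) (use \<open>0 < d\<close> z0 in \<open>auto simp: d_def\<close>)
  define H where "H = (\<lambda>z. ennreal (norm (g z) powr p * bdist \<Omega> z powr (a - 2)) * indicator \<Omega> z)"
  have [measurable]: "H \<in> borel_measurable borel" unfolding H_def
  proof (intro borel_measurable_ennreal_indicator continuous_on_mult continuous_on_powr')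
    show "continuous_on \<Omega> (\<lambda>w. norm (g w))"
      by (intro continuous_on_norm holomorphic_on_imp_continuous_on holo)
    show "continuous_on \<Omega> (bdist \<Omega>)" by (intro continuous_on_bdist continuous_on_id)
    show "\<forall>x\<in>\<Omega>. 0 \<le> bdist \<Omega> x \<and> (bdist \<Omega> x = 0 \<longrightarrow> 0 < a - 2)"
      using bdist_pos[OF \<Omega>] by fastforce
  qed (use \<open>1 < p\<close> in auto)
  have "ennreal (norm (g z0) powr p * d powr a) = ennreal (4 / pi * d powr (a - 2)) * ennreal (norm (g z0) powr p * (pi * (d / 2)\<^sup>2))"
  proof -
    have *: "d powr a = d powr (a - 2) * d\<^sup>2" using \<open>0 < d\<close> by (simp add: powr_diff)
    show ?thesis unfolding * by (simp flip: ennreal_mult) (simp add: power2_eq_square)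
  qed
  also have "\<dots> \<le> ennreal (4 / pi * d powr (a - 2)) * (\<integral>\<^sup>+w\<in>ball z0 (d / 2). ennreal (norm (g w) powr p) \<partial>lborel)"
    by (intro mult_left_mono submean_value_powr holomorphic_on_subset[OF holo sub]) (use \<open>0 < d\<close> \<open>1 < p\<close> in auto)
  also have "(\<integral>\<^sup>+w\<in>ball z0 (d / 2). ennreal (norm (g w) powr p) \<partial>lborel)
     \<le> (\<integral>\<^sup>+w. ennreal (2 powr \<bar>2 - a\<bar> * d powr (2 - a)) * H w \<partial>lborel)"
  proof (intro nn_integral_mono)
    fix w
    show "ennreal (norm (g w) powr p) * indicator (ball z0 (d / 2)) w \<le> ennreal (2 powr \<bar>2 - a\<bar> * d powr (2 - a)) * H w"
    proof (cases "w \<in> ball z0 (d / 2)")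
      case True
      then have w: "w \<in> \<Omega>" using sub by auto
      define b where "b = bdist \<Omega> w"
      have "0 < b" unfolding b_def by (rule bdist_pos[OF \<Omega> w])
      have "d \<le> b + dist z0 w" unfolding d_def b_def by (rule bdist_triangle)
      moreover have "b \<le> d + dist w z0" unfolding d_def b_def by (rule bdist_triangle)
      moreover have "dist z0 w < d / 2" using True by simp
      ultimately have b: "d \<le> 2 * b" "b \<le> 2 * d"
        using \<open>0 < d\<close> dist_commute[of z0 w] by linarith+
      have "b powr (2 - a) \<le> 2 powr \<bar>2 - a\<bar> * d powr (2 - a)"
        by (rule powr_le_of_ratio) (use b \<open>0 < b\<close> \<open>0 < d\<close> in auto)
      then have "norm (g w) powr p * b powr (a - 2) * b powr (2 - a) \<le> norm (g w) powr p * b powr (a - 2) * (2 powr \<bar>2 - a\<bar> * d powr (2 - a))"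
        by (rule mult_left_mono) simp
      also have "norm (g w) powr p * b powr (a - 2) * b powr (2 - a) = norm (g w) powr p"
        using \<open>0 < b\<close> by (simp add: mult.assoc powr_add[symmetric])
      finally show ?thesis using True w
        by (simp add: H_def b_def flip: ennreal_mult) (simp add: ennreal_leI mult_ac)
    qed simp
  qed
  also have "\<dots> = ennreal (2 powr \<bar>2 - a\<bar> * d powr (2 - a)) * (\<integral>\<^sup>+w. H w \<partial>lborel)"
    by (rule nn_integral_cmult) simp
  also have "ennreal (4 / pi * d powr (a - 2)) * \<dots> = ennreal c * (\<integral>\<^sup>+w. H w \<partial>lborel)"
    unfolding mult.assoc[symmetric] c_def by (subst ennreal_mult[symmetric]) (auto simp: mult_ac)
  finally show "ennreal (norm (g z0) powr p * bdist \<Omega> z0 powr a)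
      \<le> ennreal c * (\<integral>\<^sup>+z\<in>\<Omega>. ennreal (norm (g z) powr p * bdist \<Omega> z powr (a - 2)) \<partial>lborel)"
    by (simp add: H_def d_def mult_left_mono)
qed

text \<open>Hoelder's inequality over the cone of x yields \<delta>(x)^(-t) times the integral of
  |g'|^p \<delta>^(p-2+t). Multiplying by \<delta>(x)^(a-2) and integrating over the x that see w
  gives \<delta>(w)^b, and b + (p - 2 + t) = a + p - 2 is the required weight.\<close>

lemma weighted_poincare:
  assumes john: "john_domain \<Omega>" and z0: "z0 \<in> \<Omega>" and "1 < p"
    and dim: "assouad_dim (frontier \<Omega>) < ereal a"
  obtains C where "0 < C"
    "\<And>g. g holomorphic_on \<Omega> \<Longrightarrow>
      (\<integral>\<^sup>+z\<in>\<Omega>. ennreal (norm (g z - g z0) powr p * bdist \<Omega> z powr (a - 2)) \<partial>lborel)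
      \<le> ennreal C * (\<integral>\<^sup>+z\<in>\<Omega>. ennreal (norm (deriv g z) powr p * bdist \<Omega> z powr (a + p - 2)) \<partial>lborel)"
proof -
  note \<Omega> = john_domainD(1,3)[OF john]
  have [measurable]: "\<Omega> \<in> sets borel" using \<Omega> by auto
  obtain s0 C0 where s0: "0 \<le> s0" "s0 < a" "0 < C0" and cov:
    "\<And>x r R. x \<in> frontier \<Omega> \<Longrightarrow> 0 < r \<Longrightarrow> r < R \<Longrightarrow>
        \<exists>F. finite F \<and> real (card F) \<le> C0 * (R / r) powr s0 \<and> frontier \<Omega> \<inter> ball x R \<subseteq> (\<Union>c\<in>F. ball c r)"
    using assouad_dim_less_cover[OF dim] by blast
  \<comment> \<open>The Schur test function is \<open>\<delta>\<^sup>-\<^sup>s\<^sup>/\<^sup>q\<close>; the loss \<open>t\<close> is half the room above the Assouad dimension.\<close>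
  define t where "t = (a - s0) / 2"
  define s where "s = t / (p - 1)"
  define b where "b = a - t"
  have t: "0 < t" "s0 < b" using s0 by (auto simp: t_def b_def field_simps)
  have s: "0 < s" "s * (p - 1) = t" using t \<open>1 < p\<close> by (auto simp: s_def)
  obtain K c where "0 < K" "0 < c" and diff:
    "\<And>g x. g holomorphic_on \<Omega> \<Longrightarrow> x \<in> \<Omega> \<Longrightarrow> ennreal (norm (g x - g z0)) \<le>
        (\<integral>\<^sup>+w\<in>{w\<in>\<Omega>. dist x w \<le> K * bdist \<Omega> w}. ennreal (c * norm (deriv g w) / bdist \<Omega> w) \<partial>lborel)"
    using john_domain_norm_diff_le[OF john z0] by blast
  obtain c1 where "0 < c1" and c1: "\<And>x. x \<in> \<Omega> \<Longrightarrow>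
    (\<integral>\<^sup>+w\<in>{w\<in>\<Omega>. dist x w \<le> K * bdist \<Omega> w}. ennreal (bdist \<Omega> w powr (- 2 - s)) \<partial>lborel)
      \<le> ennreal (c1 * bdist \<Omega> x powr (- s))"
    using nn_integral_shadow_powr[OF \<Omega> \<open>0 < K\<close> s(1)] by blast
  obtain c2 where "0 < c2" and c2: "\<And>x R. x \<in> frontier \<Omega> \<Longrightarrow> 0 < R \<Longrightarrow>
      (\<integral>\<^sup>+y\<in>ball x R - frontier \<Omega>. ennreal (infdist y (frontier \<Omega>) powr (b - 2)) \<partial>lborel) \<le> ennreal (c2 * R powr b)"
    using nn_integral_infdist_powr_ball[OF frontier_closed s0(1) t(2) s0(3) cov] by blast
  define c3 where "c3 = c2 * (K + 2) powr b"
  have "0 < c3" using \<open>0 < c2\<close> \<open>0 < K\<close> by (simp add: c3_def)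
  have c3: "(\<integral>\<^sup>+x\<in>{x\<in>\<Omega>. dist x w \<le> K * bdist \<Omega> w}. ennreal (bdist \<Omega> x powr (b - 2)) \<partial>lborel)
      \<le> ennreal (c3 * bdist \<Omega> w powr b)" if "w \<in> \<Omega>" for w
    unfolding c3_def by (rule nn_integral_bdist_powr_disc[OF \<Omega> \<open>0 < K\<close> \<open>0 < c2\<close> c2 that])
  define c4 where "c4 = c1 powr (p - 1) * c powr p"
  have "0 < c4" using \<open>0 < c1\<close> \<open>0 < c\<close> by (simp add: c4_def)
  define q where "q = p / (p - 1)"
  have pq: "1 / p + 1 / q = 1" using \<open>1 < p\<close> by (simp add: q_def field_simps)
  \<comment> \<open>The exponent splits 1/\<delta> into \<delta>^(e-1) and \<delta>^(-e) so that the
    \<open>q\<close>-th power of the second factor is \<delta>^(-2-s), the integrand bounded by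
    \<open>c1\<close>.\<close>
  define e where "e = (2 + s) * (p - 1) / p"
  have e: "- e * q = - 2 - s" "(e - 1) * p = p - 2 + t"
    using \<open>1 < p\<close> s(2) by (simp_all add: e_def q_def) (simp_all add: field_simps)
  show ?thesis
  proof
    show "0 < c4 * c3" using \<open>0 < c4\<close> \<open>0 < c3\<close> by simp
    fix g assume holo: "g holomorphic_on \<Omega>"
    have holo': "deriv g holomorphic_on \<Omega>" by (rule holomorphic_deriv[OF holo \<Omega>(1)])
    \<comment> \<open>Since \<open>0 powr p = 0\<close>, the function \<open>N\<close> built from
      this cut-off vanishes off \<Omega>, and \<open>w \<in> \<Omega>\<close> need not be repeated
      in the kernels below.\<close>
    define G where "G = (\<lambda>w. indicator \<Omega> w *\<^sub>R norm (deriv g w))"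
    have [measurable]: "G \<in> borel_measurable borel" unfolding G_def
      by (intro borel_measurable_continuous_on_indicator continuous_on_norm holomorphic_on_imp_continuous_on holo') auto
    define W where "W = (\<lambda>x. {w\<in>\<Omega>. dist x w \<le> K * bdist \<Omega> w})"
    have [measurable]: "W x \<in> sets borel" for x unfolding W_def by measurable
    define N where "N = (\<lambda>w. ennreal (G w powr p * bdist \<Omega> w powr (p - 2 + t)))"
    have [measurable]: "N \<in> borel_measurable borel" unfolding N_def by measurable
    have holder: "ennreal (norm (g x - g z0) powr p)
        \<le> ennreal (c4 * bdist \<Omega> x powr (- t)) * (\<integral>\<^sup>+w. (if dist x w \<le> K * bdist \<Omega> w then N w else 0) \<partial>lborel)"
      if x: "x \<in> \<Omega>" for x
    proof -
      have \<delta>x: "0 < bdist \<Omega> x" by (rule bdist_pos[OF \<Omega> x])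
      have pos: "0 < bdist \<Omega> w" if "w \<in> W x" for w using bdist_pos[OF \<Omega>] that by (auto simp: W_def)
      define A where "A = c1 * bdist \<Omega> x powr (- s)"
      have "0 < A" using \<delta>x \<open>0 < c1\<close> by (simp add: A_def)
      define u where "u = (\<lambda>w. if w \<in> W x then c * G w * bdist \<Omega> w powr (e - 1) else 0)"
      define v where "v = (\<lambda>w. if w \<in> W x then bdist \<Omega> w powr (- e) else 0)"
      have "ennreal (norm (g x - g z0) powr p) \<le> ennreal (A powr (p - 1)) * (\<integral>\<^sup>+w. ennreal (u w powr p) \<partial>lborel)"
      proof (rule holder_nn_integral_powr[OF \<open>1 < p\<close> pq \<open>0 < A\<close>, where v = v])
        show "u \<in> borel_measurable lborel" "v \<in> borel_measurable lborel" unfolding u_def v_def by measurable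
        show "0 \<le> u w" "0 \<le> v w" for w using \<open>0 < c\<close> by (auto simp: u_def v_def G_def)
        have "(\<integral>\<^sup>+w\<in>W x. ennreal (c * norm (deriv g w) / bdist \<Omega> w) \<partial>lborel) = (\<integral>\<^sup>+w. ennreal (u w * v w) \<partial>lborel)"
        proof (intro nn_integral_cong)
          fix w
          have "u w * v w = c * norm (deriv g w) / bdist \<Omega> w" if w: "w \<in> W x"
          proof -
            have "w \<in> \<Omega>" using w by (simp add: W_def)
            have "bdist \<Omega> w powr (e - 1) * bdist \<Omega> w powr (- e) = 1 / bdist \<Omega> w"
              using pos[OF w] by (simp add: powr_diff powr_minus_divide)
            moreover have "u w * v w = c * norm (deriv g w) * (bdist \<Omega> w powr (e - 1) * bdist \<Omega> w powr (- e))"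
              using w \<open>w \<in> \<Omega>\<close> by (simp add: u_def v_def G_def)
            ultimately show ?thesis by simp
          qed
          then show "ennreal (c * norm (deriv g w) / bdist \<Omega> w) * indicator (W x) w = ennreal (u w * v w)"
            by (auto simp: u_def indicator_def)
        qed
        then show "ennreal (norm (g x - g z0)) \<le> (\<integral>\<^sup>+w. ennreal (u w * v w) \<partial>lborel)"
          using diff[OF holo x] by (simp add: W_def)
        have "(\<integral>\<^sup>+w. ennreal (v w powr q) \<partial>lborel) = (\<integral>\<^sup>+w\<in>W x. ennreal (bdist \<Omega> w powr (- 2 - s)) \<partial>lborel)"
          by (intro nn_integral_cong) (auto simp: v_def indicator_def powr_powr e(1)[symmetric])
        then show "(\<integral>\<^sup>+w. ennreal (v w powr q) \<partial>lborel) \<le> ennreal A"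
          using c1[OF x] by (simp add: W_def A_def)
      qed simp
      also have "(\<integral>\<^sup>+w. ennreal (u w powr p) \<partial>lborel)
         = (\<integral>\<^sup>+w. ennreal (c powr p) * (if dist x w \<le> K * bdist \<Omega> w then N w else 0) \<partial>lborel)"
      proof (intro nn_integral_cong)
        fix w
        show "ennreal (u w powr p) = ennreal (c powr p) * (if dist x w \<le> K * bdist \<Omega> w then N w else 0)"
        proof (cases "w \<in> W x")
          case True
          then have "u w powr p = c powr p * (G w powr p * bdist \<Omega> w powr (p - 2 + t))"
            using \<open>0 < c\<close> by (simp add: u_def powr_mult powr_powr e(2)[symmetric] G_def)
          with True show ?thesis by (simp add: N_def W_def ennreal_mult)
        next
          case False
          then have "w \<notin> \<Omega> \<or> \<not> dist x w \<le> K * bdist \<Omega> w" by (simp add: W_def)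
          then show ?thesis using False \<open>1 < p\<close> by (auto simp: u_def N_def G_def)
        qed
      qed
      also have "\<dots> = ennreal (c powr p) * (\<integral>\<^sup>+w. (if dist x w \<le> K * bdist \<Omega> w then N w else 0) \<partial>lborel)"
        by (rule nn_integral_cmult) measurable
      also have "ennreal (A powr (p - 1)) * \<dots> = ennreal (c4 * bdist \<Omega> x powr (- t)) * (\<integral>\<^sup>+w. (if dist x w \<le> K * bdist \<Omega> w then N w else 0) \<partial>lborel)"
      proof -
        have "A powr (p - 1) * c powr p = c4 * bdist \<Omega> x powr (- t)"
          using \<delta>x \<open>0 < c1\<close> s(2) by (simp add: A_def c4_def powr_mult powr_powr)
        then show ?thesis unfolding mult.assoc[symmetric] by (simp flip: ennreal_mult)
      qed
      finally show ?thesis .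
    qed
    \<comment> \<open>All dependence on x sits in the first factor, so after the exchange the inner
      integral is the one bounded by \<open>c3\<close>.\<close>
    define k where "k = (\<lambda>x w. (if x \<in> \<Omega> \<and> dist x w \<le> K * bdist \<Omega> w then ennreal (bdist \<Omega> x powr (b - 2)) else 0) * (ennreal c4 * N w))"
    have [measurable]: "(\<lambda>(x, w). k x w) \<in> borel_measurable (lborel \<Otimes>\<^sub>M lborel)" unfolding k_def by measurable
    have "(\<integral>\<^sup>+z\<in>\<Omega>. ennreal (norm (g z - g z0) powr p * bdist \<Omega> z powr (a - 2)) \<partial>lborel) \<le> (\<integral>\<^sup>+x. \<integral>\<^sup>+w. k x w \<partial>lborel \<partial>lborel)"
    proof (intro nn_integral_mono)
      fix x
      show "ennreal (norm (g x - g z0) powr p * bdist \<Omega> x powr (a - 2)) * indicator \<Omega> x \<le> (\<integral>\<^sup>+w. k x w \<partial>lborel)"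
      proof (cases "x \<in> \<Omega>")
        case True
        let ?I = "\<integral>\<^sup>+w. (if dist x w \<le> K * bdist \<Omega> w then N w else 0) \<partial>lborel"
        have *: "c4 * bdist \<Omega> x powr (- t) * bdist \<Omega> x powr (a - 2) = c4 * bdist \<Omega> x powr (b - 2)"
          unfolding mult.assoc powr_add[symmetric] by (simp add: b_def algebra_simps)
        have "ennreal (norm (g x - g z0) powr p * bdist \<Omega> x powr (a - 2)) = ennreal (norm (g x - g z0) powr p) * ennreal (bdist \<Omega> x powr (a - 2))"
          by (simp add: ennreal_mult)
        also have "\<dots> \<le> ennreal (c4 * bdist \<Omega> x powr (- t)) * ?I * ennreal (bdist \<Omega> x powr (a - 2))"
          by (intro mult_right_mono holder[OF True]) simp
        also have "\<dots> = ennreal (c4 * bdist \<Omega> x powr (- t) * bdist \<Omega> x powr (a - 2)) * ?I"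
          using \<open>0 < c4\<close> by (subst ennreal_mult) (auto simp: mult_ac)
        also have "\<dots> = (\<integral>\<^sup>+w. ennreal (c4 * bdist \<Omega> x powr (b - 2)) * (if dist x w \<le> K * bdist \<Omega> w then N w else 0) \<partial>lborel)"
          unfolding * by (rule nn_integral_cmult[symmetric]) measurable
        also have "\<dots> = (\<integral>\<^sup>+w. k x w \<partial>lborel)"
          using True \<open>0 < c4\<close> by (intro nn_integral_cong) (auto simp: k_def ennreal_mult mult_ac)
        finally show ?thesis using True by simp
      qed simp
    qed
    also have "\<dots> = (\<integral>\<^sup>+w. \<integral>\<^sup>+x. k x w \<partial>lborel \<partial>lborel)"
      by (rule lborel_pair.Fubini'[symmetric]) measurable
    also have "\<dots> \<le> (\<integral>\<^sup>+w. ennreal (c4 * c3) * (ennreal (norm (deriv g w) powr p * bdist \<Omega> w powr (a + p - 2)) * indicator \<Omega> w) \<partial>lborel)"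
    proof (intro nn_integral_mono)
      fix w
      have "(\<integral>\<^sup>+x. k x w \<partial>lborel) = (\<integral>\<^sup>+x. (if x \<in> \<Omega> \<and> dist x w \<le> K * bdist \<Omega> w then ennreal (bdist \<Omega> x powr (b - 2)) else 0) \<partial>lborel) * (ennreal c4 * N w)"
        unfolding k_def by (rule nn_integral_multc) measurable
      also have "(\<integral>\<^sup>+x. (if x \<in> \<Omega> \<and> dist x w \<le> K * bdist \<Omega> w then ennreal (bdist \<Omega> x powr (b - 2)) else 0) \<partial>lborel)
         = (\<integral>\<^sup>+x\<in>{x\<in>\<Omega>. dist x w \<le> K * bdist \<Omega> w}. ennreal (bdist \<Omega> x powr (b - 2)) \<partial>lborel)"
        by (intro nn_integral_cong) (auto simp: indicator_def)
      also have "\<dots> * (ennreal c4 * N w) \<le> ennreal (c4 * c3) * (ennreal (norm (deriv g w) powr p * bdist \<Omega> w powr (a + p - 2)) * indicator \<Omega> w)"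
      proof (cases "w \<in> \<Omega>")
        case True
        have "b + (p - 2 + t) = a + p - 2" by (simp add: b_def)
        then have *: "bdist \<Omega> w powr b * bdist \<Omega> w powr (p - 2 + t) = bdist \<Omega> w powr (a + p - 2)"
          by (simp only: powr_add[symmetric])
        have "(\<integral>\<^sup>+x\<in>{x\<in>\<Omega>. dist x w \<le> K * bdist \<Omega> w}. ennreal (bdist \<Omega> x powr (b - 2)) \<partial>lborel) * (ennreal c4 * N w)
           \<le> ennreal (c3 * bdist \<Omega> w powr b) * (ennreal c4 * N w)"
          by (intro mult_right_mono c3[OF True]) simp
        also have "\<dots> = ennreal (c3 * bdist \<Omega> w powr b * (c4 * (norm (deriv g w) powr p * bdist \<Omega> w powr (p - 2 + t))))"
          using True \<open>0 < c3\<close> \<open>0 < c4\<close> by (simp add: N_def G_def flip: ennreal_mult)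
        also have "c3 * bdist \<Omega> w powr b * (c4 * (norm (deriv g w) powr p * bdist \<Omega> w powr (p - 2 + t)))
           = c4 * c3 * (norm (deriv g w) powr p * bdist \<Omega> w powr (a + p - 2))"
          unfolding *[symmetric] by (simp add: mult_ac)
        also have "ennreal \<dots> = ennreal (c4 * c3) * ennreal (norm (deriv g w) powr p * bdist \<Omega> w powr (a + p - 2))"
          using \<open>0 < c3\<close> \<open>0 < c4\<close> by (simp add: ennreal_mult)
        finally show ?thesis using True by simp
      qed (use \<open>1 < p\<close> in \<open>simp add: N_def G_def\<close>)
      finally show "(\<integral>\<^sup>+x. k x w \<partial>lborel) \<le> ennreal (c4 * c3) * (ennreal (norm (deriv g w) powr p * bdist \<Omega> w powr (a + p - 2)) * indicator \<Omega> w)" .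
    qed
    also have "\<dots> = ennreal (c4 * c3) * (\<integral>\<^sup>+z\<in>\<Omega>. ennreal (norm (deriv g z) powr p * bdist \<Omega> z powr (a + p - 2)) \<partial>lborel)"
    proof (rule nn_integral_cmult)
      have "(\<lambda>w. ennreal (norm (deriv g w) powr p * bdist \<Omega> w powr (a + p - 2)) * indicator \<Omega> w) = (\<lambda>w. ennreal (G w powr p * bdist \<Omega> w powr (a + p - 2)))"
        using \<open>1 < p\<close> by (auto simp: G_def fun_eq_iff indicator_def)
      then show "(\<lambda>w. ennreal (norm (deriv g w) powr p * bdist \<Omega> w powr (a + p - 2)) * indicator \<Omega> w) \<in> borel_measurable lborel"
        by simp
    qed
    finally show "(\<integral>\<^sup>+z\<in>\<Omega>. ennreal (norm (g z - g z0) powr p * bdist \<Omega> z powr (a - 2)) \<partial>lborel)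
      \<le> ennreal (c4 * c3) * (\<integral>\<^sup>+z\<in>\<Omega>. ennreal (norm (deriv g z) powr p * bdist \<Omega> z powr (a + p - 2)) \<partial>lborel)" .
  qed
qed

text \<open>The constant g(z0) is added back to the oscillation estimate. Its contribution is
  |g(z0)|^p times the integral of \<delta>^(a-2), whose finiteness is a second use of the covering
  condition, now with the full exponent a.\<close>

lemma weighted_norm_le:
  assumes john: "john_domain \<Omega>" and z0: "z0 \<in> \<Omega>" and "1 < p"
    and dim: "assouad_dim (frontier \<Omega>) < ereal a"
  obtains C where "0 < C"
    "\<And>g. g holomorphic_on \<Omega> \<Longrightarrow>
      (\<integral>\<^sup>+z\<in>\<Omega>. ennreal (norm (g z) powr p * bdist \<Omega> z powr (a - 2)) \<partial>lborel)
      \<le> ennreal C * (ennreal (norm (g z0) powr p * bdist \<Omega> z0 powr a)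
          + (\<integral>\<^sup>+z\<in>\<Omega>. ennreal (norm (deriv g z) powr p * bdist \<Omega> z powr (a + p - 2)) \<partial>lborel))"
proof -
  note \<Omega> = john_domainD[OF john]
  have [measurable]: "\<Omega> \<in> sets borel" using \<Omega> by auto
  have \<delta>0: "0 < bdist \<Omega> z0" by (rule bdist_pos[OF \<Omega>(1,3) z0])
  obtain C1 where "0 < C1" and C1: "\<And>g. g holomorphic_on \<Omega> \<Longrightarrow>
      (\<integral>\<^sup>+z\<in>\<Omega>. ennreal (norm (g z - g z0) powr p * bdist \<Omega> z powr (a - 2)) \<partial>lborel)
      \<le> ennreal C1 * (\<integral>\<^sup>+z\<in>\<Omega>. ennreal (norm (deriv g z) powr p * bdist \<Omega> z powr (a + p - 2)) \<partial>lborel)"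
    using weighted_poincare[OF assms] by blast
  obtain s0 C0 where s0: "0 \<le> s0" "s0 < a" "0 < C0" and cov:
    "\<And>x r R. x \<in> frontier \<Omega> \<Longrightarrow> 0 < r \<Longrightarrow> r < R \<Longrightarrow>
        \<exists>F. finite F \<and> real (card F) \<le> C0 * (R / r) powr s0 \<and> frontier \<Omega> \<inter> ball x R \<subseteq> (\<Union>c\<in>F. ball c r)"
    using assouad_dim_less_cover[OF dim] by blast
  obtain c2 where "0 < c2" and c2: "\<And>x R. x \<in> frontier \<Omega> \<Longrightarrow> 0 < R \<Longrightarrow>
      (\<integral>\<^sup>+y\<in>ball x R - frontier \<Omega>. ennreal (infdist y (frontier \<Omega>) powr (a - 2)) \<partial>lborel) \<le> ennreal (c2 * R powr a)"
    using nn_integral_infdist_powr_ball[OF frontier_closed s0 cov] by blast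
  have "(\<integral>\<^sup>+x\<in>\<Omega>. ennreal (bdist \<Omega> x powr (a - 2)) \<partial>lborel) < \<infinity>"
    by (rule nn_integral_bdist_powr_finite[OF \<Omega> c2])
  then obtain M where M: "(\<integral>\<^sup>+x\<in>\<Omega>. ennreal (bdist \<Omega> x powr (a - 2)) \<partial>lborel) = ennreal M" "0 \<le> M"
    by (cases "\<integral>\<^sup>+x\<in>\<Omega>. ennreal (bdist \<Omega> x powr (a - 2)) \<partial>lborel") auto
  \<comment> \<open>The factor \<open>2 powr p\<close> comes from splitting g into g - g(z0) and
    g(z0); the power \<open>- a\<close> undoes the normalisation of the point term.\<close>
  define C where "C = 2 powr p * (C1 + M * bdist \<Omega> z0 powr (- a))"
  have C_ge: "2 powr p * C1 \<le> C" "2 powr p * M * bdist \<Omega> z0 powr (- a) \<le> C"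
    using \<open>0 < C1\<close> M(2) by (auto simp: C_def algebra_simps)
  show ?thesis
  proof
    show "0 < C" unfolding C_def using \<open>0 < C1\<close> M(2) by (intro mult_pos_pos add_pos_nonneg) auto
    fix g assume holo: "g holomorphic_on \<Omega>"
    let ?P = "norm (g z0) powr p"
    let ?Q = "\<integral>\<^sup>+z\<in>\<Omega>. ennreal (norm (deriv g z) powr p * bdist \<Omega> z powr (a + p - 2)) \<partial>lborel"
    have cont: "continuous_on \<Omega> g" by (intro holomorphic_on_imp_continuous_on holo)
    define D where "D = (\<lambda>z. ennreal (norm (g z - g z0) powr p * bdist \<Omega> z powr (a - 2)) * indicator \<Omega> z)"
    have [measurable]: "D \<in> borel_measurable borel" unfolding D_def
    proof (intro borel_measurable_ennreal_indicator continuous_on_mult continuous_on_powr')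
      show "continuous_on \<Omega> (\<lambda>w. norm (g w - g z0))"
        by (intro continuous_intros cont)
      show "continuous_on \<Omega> (bdist \<Omega>)" by (intro continuous_on_bdist continuous_on_id)
      show "\<forall>x\<in>\<Omega>. 0 \<le> bdist \<Omega> x \<and> (bdist \<Omega> x = 0 \<longrightarrow> 0 < a - 2)"
        using bdist_pos[OF \<Omega>(1,3)] by fastforce
    qed (use \<open>1 < p\<close> in auto)
    have "(\<integral>\<^sup>+z\<in>\<Omega>. ennreal (norm (g z) powr p * bdist \<Omega> z powr (a - 2)) \<partial>lborel)
       \<le> (\<integral>\<^sup>+z. ennreal (2 powr p) * (D z + ennreal ?P * (ennreal (bdist \<Omega> z powr (a - 2)) * indicator \<Omega> z)) \<partial>lborel)"
    proof (intro nn_integral_mono)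
      fix z
      have "norm (g z) powr p \<le> (norm (g z - g z0) + norm (g z0)) powr p"
        using \<open>1 < p\<close> norm_triangle_ineq[of "g z - g z0" "g z0"] by (intro powr_mono2) auto
      also have "\<dots> \<le> 2 powr p * (norm (g z - g z0) powr p + ?P)"
        using \<open>1 < p\<close> by (intro powr_add_le_2_powr) auto
      finally have "norm (g z) powr p * bdist \<Omega> z powr (a - 2)
         \<le> 2 powr p * (norm (g z - g z0) powr p + ?P) * bdist \<Omega> z powr (a - 2)"
        by (rule mult_right_mono) simp
      then have "ennreal (norm (g z) powr p * bdist \<Omega> z powr (a - 2))
         \<le> ennreal (2 powr p * (norm (g z - g z0) powr p * bdist \<Omega> z powr (a - 2) + ?P * bdist \<Omega> z powr (a - 2)))"
        by (intro ennreal_leI) (simp add: algebra_simps)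
      then show "ennreal (norm (g z) powr p * bdist \<Omega> z powr (a - 2)) * indicator \<Omega> z
         \<le> ennreal (2 powr p) * (D z + ennreal ?P * (ennreal (bdist \<Omega> z powr (a - 2)) * indicator \<Omega> z))"
        by (cases "z \<in> \<Omega>") (auto simp: D_def ennreal_mult ennreal_plus)
    qed
    also have "\<dots> = ennreal (2 powr p) * ((\<integral>\<^sup>+z. D z \<partial>lborel) + ennreal ?P * ennreal M)"
      by (subst nn_integral_cmult, simp, subst nn_integral_add) (simp_all add: nn_integral_cmult M(1))
    also have "\<dots> \<le> ennreal (2 powr p) * (ennreal C1 * ?Q + ennreal ?P * ennreal M)"
      using C1[OF holo] by (intro mult_left_mono add_right_mono) (auto simp: D_def)
    also have "\<dots> = ennreal (2 powr p * C1) * ?Q + ennreal (2 powr p * M * bdist \<Omega> z0 powr (- a)) * ennreal (?P * bdist \<Omega> z0 powr a)"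
    proof -
      have "2 powr p * M * bdist \<Omega> z0 powr (- a) * (?P * bdist \<Omega> z0 powr a) = 2 powr p * (?P * M)"
        using \<delta>0 by (simp add: powr_minus_divide)
      then have "ennreal (2 powr p * M * bdist \<Omega> z0 powr (- a)) * ennreal (?P * bdist \<Omega> z0 powr a) = ennreal (2 powr p) * (ennreal ?P * ennreal M)"
        using M(2) by (simp flip: ennreal_mult)
      then show ?thesis using \<open>0 < C1\<close> by (simp add: distrib_left ennreal_mult mult.assoc)
    qed
    also have "\<dots> \<le> ennreal C * ?Q + ennreal C * ennreal (?P * bdist \<Omega> z0 powr a)"
      using C_ge by (intro add_mono mult_right_mono ennreal_leI) auto
    finally show "(\<integral>\<^sup>+z\<in>\<Omega>. ennreal (norm (g z) powr p * bdist \<Omega> z powr (a - 2)) \<partial>lborel)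
      \<le> ennreal C * (ennreal (?P * bdist \<Omega> z0 powr a) + ?Q)"
      by (simp add: distrib_left add.commute)
  qed
qed

section \<open>Assembly: one constant for both inequalities\<close>

theorem corollary1p2:
  fixes \<Omega> :: "complex set" and z0 :: complex and p :: real and m :: nat
  assumes "john_domain \<Omega>"
    and "z0 \<in> \<Omega>"
    and "1 < p"
    and "1 \<le> m"
    and "assouad_dim (frontier \<Omega>) < ereal (real m * p)"
  shows "\<exists>C\<ge>1. \<forall>f. f analytic_on \<Omega> \<longrightarrow>
    ennreal (inverse C) *
        (\<integral>\<^sup>+z\<in>\<Omega>. ennreal (norm ((deriv ^^ m) f z) powr p * bdist \<Omega> z powr (real m * p - 2)) \<partial>lborel)
      \<le> ennreal (norm ((deriv ^^ m) f z0) powr p * bdist \<Omega> z0 powr (real m * p))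
        + (\<integral>\<^sup>+z\<in>\<Omega>. ennreal (norm ((deriv ^^ (m + 1)) f z) powr p
              * bdist \<Omega> z powr (real (m + 1) * p - 2)) \<partial>lborel)
    \<and>
    ennreal (norm ((deriv ^^ m) f z0) powr p * bdist \<Omega> z0 powr (real m * p))
        + (\<integral>\<^sup>+z\<in>\<Omega>. ennreal (norm ((deriv ^^ (m + 1)) f z) powr p
              * bdist \<Omega> z powr (real (m + 1) * p - 2)) \<partial>lborel)
      \<le> ennreal C *
        (\<integral>\<^sup>+z\<in>\<Omega>. ennreal (norm ((deriv ^^ m) f z) powr p * bdist \<Omega> z powr (real m * p - 2)) \<partial>lborel)"
proof -
  note \<Omega> = john_domainD(1,3)[OF assms(1)]
  define a where "a = real m * p"
  have a': "real (m + 1) * p - 2 = a + p - 2" by (simp add: a_def algebra_simps)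
  define L where "L = (\<lambda>g :: complex \<Rightarrow> complex. \<integral>\<^sup>+z\<in>\<Omega>. ennreal (norm (g z) powr p * bdist \<Omega> z powr (a - 2)) \<partial>lborel)"
  define P where "P = (\<lambda>g :: complex \<Rightarrow> complex. ennreal (norm (g z0) powr p * bdist \<Omega> z0 powr a))"
  define Q where "Q = (\<lambda>g :: complex \<Rightarrow> complex. \<integral>\<^sup>+z\<in>\<Omega>. ennreal (norm (deriv g z) powr p * bdist \<Omega> z powr (a + p - 2)) \<partial>lborel)"
  obtain C1 where C1: "0 < C1" "\<And>g. g holomorphic_on \<Omega> \<Longrightarrow> L g \<le> ennreal C1 * (P g + Q g)"
    using weighted_norm_le[OF assms(1-3) assms(5)[folded a_def]] unfolding L_def P_def Q_def by blast
  obtain C2 where C2: "0 < C2" "\<And>g. g holomorphic_on \<Omega> \<Longrightarrow> P g \<le> ennreal C2 * L g"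
    using weighted_point_le[OF \<Omega> assms(3,2)] unfolding L_def P_def by blast
  obtain C3 where C3: "0 < C3" "\<And>g. g holomorphic_on \<Omega> \<Longrightarrow> Q g \<le> ennreal C3 * L g"
    using weighted_deriv_le[OF \<Omega> assms(3)] unfolding L_def Q_def by blast
  \<comment> \<open>\<open>C1\<close> serves the first inequality through its inverse,
    \<open>C2 + C3\<close> the second, and the summand 1 secures \<open>C \<ge> 1\<close>. All are
    fixed before \<open>f\<close> is chosen.\<close>
  define C where "C = 1 + C1 + C2 + C3"
  have C: "1 \<le> C" "C1 \<le> C" "C2 + C3 \<le> C" using C1(1) C2(1) C3(1) by (auto simp: C_def)
  have main: "ennreal (inverse C) * L g \<le> P g + Q g \<and> P g + Q g \<le> ennreal C * L g"
    if holo: "g holomorphic_on \<Omega>" for g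
  proof
    have "ennreal (inverse C) * L g \<le> ennreal (inverse C) * (ennreal C1 * (P g + Q g))"
      by (intro mult_left_mono C1(2)[OF holo]) simp
    also have "\<dots> = ennreal (inverse C * C1) * (P g + Q g)"
      using C C1(1) by (simp add: ennreal_mult mult.assoc)
    also have "\<dots> \<le> ennreal 1 * (P g + Q g)"
      using C by (intro mult_right_mono ennreal_leI) (auto simp: field_simps)
    finally show "ennreal (inverse C) * L g \<le> P g + Q g" by simp
    have "P g + Q g \<le> ennreal C2 * L g + ennreal C3 * L g"
      by (intro add_mono C2(2) C3(2) holo)
    also have "\<dots> = ennreal (C2 + C3) * L g" using C2(1) C3(1) by (simp add: distrib_right)
    also have "\<dots> \<le> ennreal C * L g" using C by (intro mult_right_mono ennreal_leI) auto
    finally show "P g + Q g \<le> ennreal C * L g" .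
  qed
  show ?thesis
  proof (intro exI[of _ C] conjI[OF C(1)] allI impI)
    fix f assume "f analytic_on \<Omega>"
    then have "(deriv ^^ m) f holomorphic_on \<Omega>"
      using \<Omega>(1) by (intro holomorphic_higher_deriv analytic_imp_holomorphic)
    from main[OF this] show "ennreal (inverse C) *
        (\<integral>\<^sup>+z\<in>\<Omega>. ennreal (norm ((deriv ^^ m) f z) powr p * bdist \<Omega> z powr (real m * p - 2)) \<partial>lborel)
      \<le> ennreal (norm ((deriv ^^ m) f z0) powr p * bdist \<Omega> z0 powr (real m * p))
        + (\<integral>\<^sup>+z\<in>\<Omega>. ennreal (norm ((deriv ^^ (m + 1)) f z) powr p
              * bdist \<Omega> z powr (real (m + 1) * p - 2)) \<partial>lborel)
    \<and>
    ennreal (norm ((deriv ^^ m) f z0) powr p * bdist \<Omega> z0 powr (real m * p))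
        + (\<integral>\<^sup>+z\<in>\<Omega>. ennreal (norm ((deriv ^^ (m + 1)) f z) powr p
              * bdist \<Omega> z powr (real (m + 1) * p - 2)) \<partial>lborel)
      \<le> ennreal C *
        (\<integral>\<^sup>+z\<in>\<Omega>. ennreal (norm ((deriv ^^ m) f z) powr p * bdist \<Omega> z powr (real m * p - 2)) \<partial>lborel)"
      unfolding a' L_def P_def Q_def by (simp add: a_def)
  qed
qed

end
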